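(* Let $(b,c)$ be one of the pairs $(2,2)$ or $(1,4)$, let $\mathcal{B}$ be the canonical basis of $\mathcal{A}(b,c)$, and let $\alpha\mapsto x[\alpha]$ be the bijection $Q=\mathbb{Z}^2\to\mathcal{B}$ described in the context. Let $\delta=(1,1)$ if $(b,c)=(2,2)$ and $\delta=(1,2)$ if $(b,c)=(1,4)$. Then $x[n\delta]=z_n$ for all integers $n>0$.
   Context: Let $\mathcal{F}=\mathbb{Q}(y_1,y_2)$ be the field of rational functions in two commuting independent variables. For positive integers $b,c$ define $y_m\in\mathcal{F}$ for all $m\in\mathbb{Z}$ recursively by $y_{m-1}y_{m+1}=y_m^b+1$ for $m$ odd and $y_{m-1}y_{m+1}=y_m^c+1$ for $m$ even. The cluster algebra $\mathcal{A}(b,c)$ is the subring of $\mathcal{F}$ generated by all $y_m$, $m\in\mathbb{Z}$. It is known (Laurent phenomenon) that for each $m\in\mathbb{Z}$ every element of $\mathcal{A}(b,c)$ is uniquely a Laurent polynomial with integer coefficients in $y_m$ and $y_{m+1}$. Define $z\in\mathcal{A}(b,c)$ by $z=y_0y_3-y_1y_2$ if $(b,c)=(2,2)$, and $z=y_0^2y_3-(y_1+2)y_2^2$ if $(b,c)=(1,4)$. Let $T_0=1$ and, for $n>0$, let $T_n$ be the polynomial with $T_n(t+t^{-1})=t^n+t^{-n}$. Put $z_n=T_n(z)$ for $n\ge1$. A non-zero element $y\in\mathcal{A}(b,c)$ is called positive if for every $m\in\mathbb{Z}$ all the (non-zero) coefficients in the expansion of $y$ as a Laurent polynomial in $y_m$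 and $y_{m+1}$ are positive. When $bc\le 4$, the canonical basis $\mathcal{B}$ is the unique $\mathbb{Z}$-basis of $\mathcal{A}(b,c)$ such that the set of positive elements consists precisely of the positive integer linear combinations of elements of $\mathcal{B}$ (existence and uniqueness is a theorem of the same paper). Also by a theorem of the same paper, for $bc\le4$ and every $\alpha=(a_1,a_2)\in Q=\mathbb{Z}^2$ there is a unique element $x[\alpha]\in\mathcal{B}$ of the form $N_\alpha(y_1,y_2)/(y_1^{a_1}y_2^{a_2})$ with $N_\alpha$ a polynomial with constant term $1$, and $\alpha\mapsto x[\alpha]$ is a bijection $Q\to\mathcal{B}$. *)

theory Defs
  imports "HOL-Computational_Algebra.Computational_Algebra"
begin

text \<open>
  The field of rational functions in two independent variables, as the fraction field of the
  bivariate polynomial ring: the inner polynomial variable is the first one (\<open>y\<^sub>1\<close>), the outer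
  polynomial variable is the second one (\<open>y\<^sub>2\<close>).
\<close>
type_synonym ratfun = "rat poly poly fract"

definition cluster_exponent :: "nat \<Rightarrow> nat \<Rightarrow> int \<Rightarrow> nat" where
  "cluster_exponent b c m = (if odd m then b else c)"

text \<open>
  The relation \<open>y\<^sub>m\<^sub>-\<^sub>1 y\<^sub>m\<^sub>+\<^sub>1 = y\<^sub>m ^ cluster_exponent b c m + 1\<close> is solved upwards from
  \<open>y\<^sub>1, y\<^sub>2\<close> for \<open>m > 2\<close> and downwards for \<open>m < 1\<close>. No division by zero takes
  place, and the relation holds for every integer \<open>m\<close>; see \<open>cluster_var_nonzero\<close> and
  \<open>cluster_var_exchange\<close> below.
\<close>
function cluster_var :: "nat \<Rightarrow> nat \<Rightarrow> int \<Rightarrow> ratfun" where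
  "cluster_var b c m =
     (if m = 1 then Fract [:[:0, 1:]:] 1
      else if m = 2 then Fract [:0, 1:] 1
      else if m > 2 then
        (cluster_var b c (m - 1) ^ cluster_exponent b c (m - 1) + 1) / cluster_var b c (m - 2)
      else
        (cluster_var b c (m + 1) ^ cluster_exponent b c (m + 1) + 1) / cluster_var b c (m + 2))"
  by pat_completeness auto
termination
  by (relation "measure (\<lambda>(b, c, m). nat \<bar>2 * m - 3\<bar>)") auto

declare cluster_var.simps [simp del]

inductive_set cluster_algebra :: "nat \<Rightarrow> nat \<Rightarrow> ratfun set" for b c :: nat where
  var: "cluster_var b c m \<in> cluster_algebra b c"
| one: "1 \<in> cluster_algebra b c"
| diff: "u \<in> cluster_algebra b c \<Longrightarrow> v \<in> cluster_algebra b c \<Longrightarrow> u - v \<in> cluster_algebra b c"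
| mult: "u \<in> cluster_algebra b c \<Longrightarrow> v \<in> cluster_algebra b c \<Longrightarrow> u * v \<in> cluster_algebra b c"

text \<open>
  \<open>k (i, j)\<close> is the coefficient of \<open>y\<^sub>m\<^sup>i y\<^sub>m\<^sub>+\<^sub>1\<^sup>j\<close>.
\<close>
definition laurent_expansion :: "nat \<Rightarrow> nat \<Rightarrow> int \<Rightarrow> ratfun \<Rightarrow> (int \<times> int \<Rightarrow> int) \<Rightarrow> bool" where
  "laurent_expansion b c m u k \<longleftrightarrow>
     finite {e. k e \<noteq> 0} \<and>
     u = (\<Sum>e | k e \<noteq> 0.
            of_int (k e) * (cluster_var b c m powi fst e * cluster_var b c (m + 1) powi snd e))"

text \<open>
  Every element of the cluster algebra has exactly one Laurent expansion in each cluster, so the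
  existential quantifier below speaks about that expansion.
\<close>
definition positive_elements :: "nat \<Rightarrow> nat \<Rightarrow> ratfun set" where
  "positive_elements b c =
     {u \<in> cluster_algebra b c. u \<noteq> 0 \<and>
        (\<forall>m. \<exists>k. laurent_expansion b c m u k \<and> (\<forall>e. k e \<noteq> 0 \<longrightarrow> k e > 0))}"

definition positive_combinations :: "ratfun set \<Rightarrow> ratfun set" where
  "positive_combinations B =
     {\<Sum>w\<in>S. of_int (k w) * w | S k. finite S \<and> S \<noteq> {} \<and> S \<subseteq> B \<and> (\<forall>w\<in>S. k w > (0 :: int))}"

interpretation int_mod: module "\<lambda>(k :: int) (u :: ratfun). of_int k * u"
  by unfold_locales (simp_all add: algebra_simps)

definition integer_basis :: "ratfun set \<Rightarrow> ratfun set \<Rightarrow> bool" where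
  "integer_basis A B \<longleftrightarrow> int_mod.independent B \<and> int_mod.span B = A"

definition canonical_basis :: "nat \<Rightarrow> nat \<Rightarrow> ratfun set \<Rightarrow> bool" where
  "canonical_basis b c B \<longleftrightarrow>
     integer_basis (cluster_algebra b c) B \<and> positive_elements b c = positive_combinations B"

text \<open>
  \<open>Fract N 1\<close> is \<open>N(y\<^sub>1, y\<^sub>2)\<close>, and \<open>coeff (coeff N 0) 0\<close> is the constant term of \<open>N\<close>.
\<close>
definition has_denominator :: "nat \<Rightarrow> nat \<Rightarrow> int \<times> int \<Rightarrow> ratfun \<Rightarrow> bool" where
  "has_denominator b c \<alpha> u \<longleftrightarrow>
     (\<exists>N. coeff (coeff N 0) 0 = 1 \<and>
        u = Fract N 1 / (cluster_var b c 1 powi fst \<alpha> * cluster_var b c 2 powi snd \<alpha>))"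

text \<open>
  The characterisation determines a unique polynomial by \<open>cheb_T_ex1\<close> below. For \<open>n = 0\<close> it
  would give the constant 2 instead of the conventional \<open>T\<^sub>0 = 1\<close>.
\<close>
definition cheb_T :: "nat \<Rightarrow> int poly" where
  "cheb_T n = (if n = 0 then 1
     else THE P. \<forall>t :: rat. t \<noteq> 0 \<longrightarrow>
            poly (map_poly of_int P) (t + inverse t) = t ^ n + inverse t ^ n)"

text \<open>Only the values at \<open>(2, 2)\<close> and \<open>(1, 4)\<close> are meaningful.\<close>
definition z_elem :: "nat \<Rightarrow> nat \<Rightarrow> ratfun" where
  "z_elem b c =
     (let y = cluster_var b c in
      if (b, c) = (2, 2) then y 0 * y 3 - y 1 * y 2
      else if (b, c) = (1, 4) then y 0 ^ 2 * y 3 - (y 1 + 2) * y 2 ^ 2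
      else undefined)"

definition z_seq :: "nat \<Rightarrow> nat \<Rightarrow> nat \<Rightarrow> ratfun" where
  "z_seq b c n = poly (map_poly of_int (cheb_T n)) (z_elem b c)"

definition delta :: "nat \<Rightarrow> nat \<Rightarrow> int \<times> int" where
  "delta b c = (if (b, c) = (2, 2) then (1, 1) else if (b, c) = (1, 4) then (1, 2) else undefined)"


subsection \<open>The recursion for the cluster variables is well posed\<close>

definition nn_poly :: "rat poly poly \<Rightarrow> bool" where
  "nn_poly p \<longleftrightarrow> (\<forall>i j. coeff (coeff p i) j \<ge> 0)"

definition subtraction_free :: "ratfun \<Rightarrow> bool" where
  "subtraction_free f \<longleftrightarrow> (\<exists>p q. nn_poly p \<and> nn_poly q \<and> p \<noteq> 0 \<and> q \<noteq> 0 \<and> f = Fract p q)"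

lemma nn_poly_mult: "nn_poly p \<Longrightarrow> nn_poly q \<Longrightarrow> nn_poly (p * q)"
  by (auto simp: nn_poly_def coeff_mult coeff_sum intro!: sum_nonneg mult_nonneg_nonneg)

lemma nn_poly_add: "nn_poly p \<Longrightarrow> nn_poly q \<Longrightarrow> nn_poly (p + q)"
  by (auto simp: nn_poly_def)

lemma nn_poly_add_nonzero:
  assumes "nn_poly p" "nn_poly q" "p \<noteq> 0"
  shows "p + q \<noteq> 0"
proof
  assume "p + q = 0"
  then have "coeff (coeff p i) j + coeff (coeff q i) j = 0" for i j
    by (metis coeff_0 coeff_add)
  moreover have "coeff (coeff p i) j \<ge> 0" "coeff (coeff q i) j \<ge> 0" for i j
    using assms by (auto simp: nn_poly_def)
  ultimately have "coeff (coeff p i) j = 0" for i j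
    by (metis add_nonneg_eq_0_iff)
  then have "p = 0" by (intro poly_eqI) simp
  with assms show False by simp
qed

lemma subtraction_free_nonzero: "subtraction_free f \<Longrightarrow> f \<noteq> 0"
  by (auto simp: subtraction_free_def Zero_fract_def eq_fract)

lemma subtraction_free_one: "subtraction_free 1"
  unfolding subtraction_free_def
  by (intro exI[of _ 1]) (auto simp: nn_poly_def One_fract_def coeff_1)

lemma subtraction_free_mult: "subtraction_free f \<Longrightarrow> subtraction_free g \<Longrightarrow> subtraction_free (f * g)"
  unfolding subtraction_free_def by (metis mult_fract mult_eq_0_iff nn_poly_mult)

lemma subtraction_free_inverse: "subtraction_free f \<Longrightarrow> subtraction_free (inverse f)"
  unfolding subtraction_free_def by (metis inverse_fract)

lemma subtraction_free_divide: "subtraction_free f \<Longrightarrow> subtraction_free g \<Longrightarrow> subtraction_free (f / g)"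
  by (simp add: divide_inverse subtraction_free_mult subtraction_free_inverse)

lemma subtraction_free_add:
  assumes "subtraction_free f" "subtraction_free g"
  shows "subtraction_free (f + g)"
proof -
  obtain p q where f: "nn_poly p" "nn_poly q" "p \<noteq> 0" "q \<noteq> 0" "f = Fract p q"
    using assms unfolding subtraction_free_def by blast
  obtain r s where g: "nn_poly r" "nn_poly s" "r \<noteq> 0" "s \<noteq> 0" "g = Fract r s"
    using assms unfolding subtraction_free_def by blast
  have "p * s + r * q \<noteq> 0"
    using f g by (intro nn_poly_add_nonzero nn_poly_mult) auto
  then show ?thesis
    unfolding subtraction_free_def using f g
    by (intro exI[of _ "p * s + r * q"] exI[of _ "q * s"]) (auto intro: nn_poly_mult nn_poly_add)
qed

lemma subtraction_free_power: "subtraction_free f \<Longrightarrow> subtraction_free (f ^ n)"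
  by (induction n) (auto intro: subtraction_free_one subtraction_free_mult)

lemma subtraction_free_cluster_var: "subtraction_free (cluster_var b c m)"
proof (induction b c m rule: cluster_var.induct)
  case (1 b c m)
  have "subtraction_free (Fract [:[:0, 1:]:] 1)"
    unfolding subtraction_free_def
    by (intro exI[of _ "[:[:0, 1:]:]"] exI[of _ 1])
       (auto simp: nn_poly_def coeff_pCons coeff_1 split: nat.splits)
  moreover have "subtraction_free (Fract [:0, 1:] 1)"
    unfolding subtraction_free_def
    by (intro exI[of _ "[:0, 1:]"] exI[of _ 1])
       (auto simp: nn_poly_def coeff_pCons coeff_1 split: nat.splits)
  ultimately show ?case
    using 1 by (subst cluster_var.simps)
      (auto intro!: subtraction_free_divide subtraction_free_add subtraction_free_power
        subtraction_free_one)
qed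

lemma cluster_var_nonzero: "cluster_var b c m \<noteq> 0"
  using subtraction_free_cluster_var subtraction_free_nonzero by blast

lemma cluster_var_exchange:
  "cluster_var b c (m - 1) * cluster_var b c (m + 1)
     = cluster_var b c m ^ (if odd m then b else c) + 1"
proof (cases "m \<ge> 2")
  case True
  then show ?thesis
    by (subst (2) cluster_var.simps)
       (auto simp: cluster_var_nonzero cluster_exponent_def add.commute)
next
  case False
  then show ?thesis
    by (subst (1) cluster_var.simps)
       (auto simp: cluster_var_nonzero cluster_exponent_def add.commute)
qed


subsection \<open>The polynomials \<open>T\<^sub>n\<close> are well defined\<close>

lemma map_poly_of_int_diff:
  "map_poly of_int (p - q) = (map_poly of_int p - map_poly of_int q :: 'a :: comm_ring_1 poly)"
  by (intro poly_eqI) (simp add: coeff_map_poly)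

lemma map_poly_of_int_mult:
  "map_poly of_int (p * q) = (map_poly of_int p * map_poly of_int q :: 'a :: comm_ring_1 poly)"
  by (intro poly_eqI) (simp add: coeff_map_poly coeff_mult)

lemma cheb_T_exists:
  "\<exists>P :: int poly. \<forall>t :: rat. t \<noteq> 0 \<longrightarrow>
     poly (map_poly of_int P) (t + inverse t) = t ^ n + inverse t ^ n"
proof (induction n rule: less_induct)
  case (less n)
  consider "n = 0" | "n = 1" | k where "n = Suc (Suc k)"
    by (metis One_nat_def not0_implies_Suc)
  then show ?case
  proof cases
    case 1
    then show ?thesis by (intro exI[of _ "[:2:]"]) (simp add: map_poly_pCons)
  next
    case 2
    then show ?thesis by (intro exI[of _ "[:0, 1:]"]) (simp add: map_poly_pCons)
  next
    case (3 k)
    obtain P where P: "\<And>t :: rat. t \<noteq> 0 \<Longrightarrow>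
        poly (map_poly of_int P) (t + inverse t) = t ^ k + inverse t ^ k"
      using less.IH[of k] 3 by auto
    obtain R where R: "\<And>t :: rat. t \<noteq> 0 \<Longrightarrow>
        poly (map_poly of_int R) (t + inverse t) = t ^ Suc k + inverse t ^ Suc k"
      using less.IH[of "Suc k"] 3 by auto
    have "poly (map_poly of_int ([:0, 1:] * R - P)) (t + inverse t) = t ^ n + inverse t ^ n"
      if t: "t \<noteq> 0" for t :: rat
    proof -
      have "poly (map_poly of_int ([:0, 1:] * R - P)) (t + inverse t)
          = (t + inverse t) * (t ^ Suc k + inverse t ^ Suc k) - (t ^ k + inverse t ^ k)"
        by (simp only: map_poly_of_int_diff map_poly_of_int_mult poly_diff poly_mult P[OF t] R[OF t])
           (simp add: map_poly_pCons)
      also have "\<dots> = t ^ n + inverse t ^ n"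
        using t by (simp add: 3 field_simps)
      finally show ?thesis .
    qed
    then show ?thesis by blast
  qed
qed

lemma cheb_T_ex1:
  "\<exists>!P :: int poly. \<forall>t :: rat. t \<noteq> 0 \<longrightarrow>
     poly (map_poly of_int P) (t + inverse t) = t ^ n + inverse t ^ n"
proof (rule ex_ex1I[OF cheb_T_exists])
  fix P R :: "int poly"
  assume P: "\<forall>t :: rat. t \<noteq> 0 \<longrightarrow>
      poly (map_poly of_int P) (t + inverse t) = t ^ n + inverse t ^ n"
    and R: "\<forall>t :: rat. t \<noteq> 0 \<longrightarrow>
      poly (map_poly of_int R) (t + inverse t) = t ^ n + inverse t ^ n"
  let ?D = "map_poly of_int (P - R) :: rat poly"
  let ?g = "\<lambda>t :: rat. t + inverse t"
  have "inj_on ?g {1..}"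
  proof (rule inj_onI)
    fix s t :: rat assume st: "s \<in> {1..}" "t \<in> {1..}" "?g s = ?g t"
    then have "(s - t) * (s * t - 1) = 0"
      by (simp add: field_simps)
    then consider "s = t" | "s * t = 1" by auto
    then show "s = t"
    proof cases
      case 2
      have "s * 1 \<le> s * t" "1 * t \<le> s * t"
        using st by (intro mult_left_mono mult_right_mono; simp)+
      with 2 st show ?thesis by simp
    qed
  qed
  then have "infinite (?g ` {1..})"
    using infinite_Ici[of "1 :: rat"] finite_imageD by blast
  moreover have "?g ` {1..} \<subseteq> {x. poly ?D x = 0}"
    using P R by (auto simp: map_poly_of_int_diff)
  ultimately have "infinite {x. poly ?D x = 0}"
    using finite_subset by blast
  then have "?D = 0"
    using poly_roots_finite by blast
  then show "P = R"
    by (simp add: poly_eq_iff coeff_map_poly)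
qed

lemma cheb_T_identity:
  assumes "n > 0" "t \<noteq> 0"
  shows "poly (map_poly of_int (cheb_T n)) (t + inverse t) = t ^ n + inverse (t :: rat) ^ n"
  using theI'[OF cheb_T_ex1[of n]] assms unfolding cheb_T_def by simp

end

theory Submission
  imports Defs
begin

text \<open>
  The positive elements are the positive combinations of \<open>\<B>\<close>, so a positive element that is
  not a sum of two positive elements must belong to \<open>\<B>\<close>. It therefore suffices to show that
  \<open>z\<^sub>n\<close> is positive, that it is indecomposable in this sense, and that its denominator vector
  is \<open>n\<delta>\<close>.

  Put \<open>h = c / 2\<close>. In every cluster, with \<open>X\<close> its variable of odd index and \<open>Y\<close> its variable
  of even index,
  \<open>z = X Y\<^sup>-\<^sup>h + X\<^sup>-\<^sup>1 Y\<^sup>h + X\<^sup>-\<^sup>1 Y\<^sup>-\<^sup>h + (2 h - 2) Y\<^sup>-\<^sup>h\<close> (\<open>z_laurent\<close>). Splitting off the first term as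
  \<open>a\<close>, one has \<open>z = a + d\<close> where \<open>d\<close> and \<open>a d - 1\<close> have nonnegative coefficients, and
  \<open>z\<^sub>n = T\<^sub>n(a + d)\<close> is the trace of the \<open>n\<close>-th power of the matrix with rows \<open>(a, a d - 1)\<close> and
  \<open>(1, d)\<close>. This gives positivity (\<open>lucas_in_semiring\<close>, \<open>lucas_z_positive\<close>).

  In the initial cluster the Newton polygon of \<open>z\<^sub>n\<close> is the triangle with vertices
  \<open>(-n, -nh)\<close>, \<open>(n, -nh)\<close>, \<open>(-n, nh)\<close>. Its right-angled corner has coefficient 1, which is the
  statement on the denominator, and its hypotenuse carries no terms besides the end points
  (\<open>lucas_z_terms\<close>).

  For indecomposability, suppose \<open>z\<^sub>n = u + v\<close> with \<open>u, v\<close> positive. Nothing cancels, so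
  \<open>u\<close> and \<open>v\<close> live in the triangle and one of them, say \<open>v\<close>, misses the corner. Since \<open>v\<close> is
  also a Laurent polynomial in the two neighbouring clusters, its coefficient at
  \<open>y\<^sub>1\<^sup>-\<^sup>p\<close> is divisible by \<open>(y\<^sub>2\<^sup>c + 1)\<^sup>p\<close> and its coefficient at \<open>y\<^sub>2\<^sup>-\<^sup>q\<close> by \<open>(y\<^sub>1\<^sup>b + 1)\<^sup>q\<close>
  (\<open>short_edge_vanishes\<close>). A leg of the triangle with the corner removed is too short for
  such a factor, so both legs vanish. What remains lies strictly below the hypotenuse, and
  there one of the two legs is again too short; stripping legs one at a time leaves nothing
  (\<open>triangle_vanishes\<close>), whence \<open>v = 0\<close>, a contradiction.
\<close>

section \<open>Laurent sums in two elements of a field\<close>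

definition lmon :: "'a :: field \<Rightarrow> 'a \<Rightarrow> int \<times> int \<Rightarrow> 'a" where
  "lmon X Y e = X powi fst e * Y powi snd e"

definition lsum :: "'a :: field \<Rightarrow> 'a \<Rightarrow> (int \<times> int \<Rightarrow> int) \<Rightarrow> 'a" where
  "lsum X Y k = (\<Sum>e | k e \<noteq> 0. of_int (k e) * lmon X Y e)"

lemma lmon_mult:
  assumes "X \<noteq> 0" "Y \<noteq> 0"
  shows "lmon X Y (i, j) * lmon X Y (i', j') = lmon X Y (i + i', j + j')"
  using assms by (simp add: lmon_def power_int_add)

lemma lsum_superset:
  assumes "finite F" "{e. k e \<noteq> 0} \<subseteq> F"
  shows "lsum X Y k = (\<Sum>e\<in>F. of_int (k e) * lmon X Y e)"
  unfolding lsum_def by (rule sum.mono_neutral_left) (use assms in auto)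

lemma finite_support_add:
  fixes k l :: "'e \<Rightarrow> int"
  assumes "finite {e. k e \<noteq> 0}" "finite {e. l e \<noteq> 0}"
  shows "finite {e. k e + l e \<noteq> 0}"
  by (rule finite_subset[OF _ finite_UnI[OF assms]]) auto

lemma lsum_add:
  assumes "finite {e. k e \<noteq> 0}" "finite {e. l e \<noteq> 0}"
  shows "lsum X Y (\<lambda>e. k e + l e) = lsum X Y k + lsum X Y l"
proof -
  let ?F = "{e. k e \<noteq> 0} \<union> {e. l e \<noteq> 0}"
  have "finite ?F" using assms by simp
  moreover have "{e. k e + l e \<noteq> 0} \<subseteq> ?F" by auto
  ultimately show ?thesis
    by (simp add: lsum_superset[of ?F] sum.distrib[symmetric] algebra_simps)
qed

lemma lsum_uminus: "lsum X Y (\<lambda>e. - k e) = - lsum X Y k"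
  by (simp add: lsum_def sum_negf)

lemma finite_support_swap:
  fixes k :: "int \<times> int \<Rightarrow> int"
  assumes "finite {e. k e \<noteq> 0}"
  shows "finite {e. (k \<circ> prod.swap) e \<noteq> 0}"
proof -
  have "{e. (k \<circ> prod.swap) e \<noteq> 0} = prod.swap ` {e. k e \<noteq> 0}"
    by force
  then show ?thesis using assms by simp
qed

lemma lsum_swap: "lsum Y X (k \<circ> prod.swap) = lsum X Y k"
  unfolding lsum_def
  by (rule sum.reindex_bij_witness[of _ prod.swap prod.swap]) (auto simp: lmon_def mult_ac)

definition laurent_independent :: "'a :: field \<Rightarrow> 'a \<Rightarrow> bool" where
  "laurent_independent X Y \<longleftrightarrow>
     (\<forall>k. finite {e. k e \<noteq> 0} \<longrightarrow> lsum X Y k = 0 \<longrightarrow> (\<forall>e. k e = 0))"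

lemma laurent_independent_swap:
  assumes "laurent_independent X Y"
  shows "laurent_independent Y X"
  unfolding laurent_independent_def
proof (intro allI impI)
  fix k :: "int \<times> int \<Rightarrow> int" and e :: "int \<times> int"
  assume "finite {e. k e \<noteq> 0}" "lsum Y X k = 0"
  then have "finite {e. (k \<circ> prod.swap) e \<noteq> 0}" "lsum X Y (k \<circ> prod.swap) = 0"
    by (simp_all add: finite_support_swap lsum_swap del: o_apply)
  then have "(k \<circ> prod.swap) (prod.swap e) = 0"
    using assms unfolding laurent_independent_def by blast
  then show "k e = 0" by simp
qed

lemma laurent_independent_unique:
  assumes "laurent_independent X Y" "finite {e. k e \<noteq> 0}" "finite {e. l e \<noteq> 0}"
    and "lsum X Y k = lsum X Y l"
  shows "k = l"
proof -
  have neg: "finite {e. - l e \<noteq> 0}" using assms(3) by simp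
  have "lsum X Y (\<lambda>e. k e + - l e) = 0"
    using assms(4) lsum_uminus[of X Y l] lsum_add[OF assms(2) neg, of X Y] by simp
  moreover have "finite {e. k e + - l e \<noteq> 0}"
    by (rule finite_support_add[OF assms(2) neg])
  ultimately have "\<forall>e. k e + - l e = 0"
    using assms(1)[unfolded laurent_independent_def, rule_format, of "\<lambda>e. k e + - l e"] by simp
  then show ?thesis by auto
qed

text \<open>
  The parameters \<open>C\<close> and \<open>S\<close> restrict the coefficients and the exponents.
  With \<open>C = {0..}\<close> and \<open>S = UNIV\<close> this is the semiring of Laurent sums with nonnegative
  coefficients; with \<open>C = UNIV\<close> and a polygon \<open>S\<close> it records a bound on a Newton polygon.
\<close>
inductive_set laurent_span ::
    "'a :: field \<Rightarrow> 'a \<Rightarrow> int set \<Rightarrow> (int \<times> int) set \<Rightarrow> 'a set"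
  for X Y :: "'a :: field" and C S where
  zero: "0 \<in> laurent_span X Y C S"
| add_term: "u \<in> laurent_span X Y C S \<Longrightarrow> e \<in> S \<Longrightarrow> a \<in> C \<Longrightarrow>
    u + of_int a * lmon X Y e \<in> laurent_span X Y C S"

lemma span_add:
  assumes "u \<in> laurent_span X Y C S" "v \<in> laurent_span X Y C S"
  shows "u + v \<in> laurent_span X Y C S"
  using assms(2)
  by induction (auto simp: assms(1) add.assoc[symmetric] intro: laurent_span.intros)

lemma span_term:
  assumes "e \<in> S" "a \<in> C"
  shows "of_int a * lmon X Y e \<in> laurent_span X Y C S"
  using laurent_span.add_term[OF laurent_span.zero assms, of X Y] by simp

lemma span_lmon:
  assumes "e \<in> S" "1 \<in> C"
  shows "lmon X Y e \<in> laurent_span X Y C S"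
  using span_term[OF assms, of X Y] by simp

lemma span_mono:
  assumes "u \<in> laurent_span X Y C S" "S \<subseteq> T"
  shows "u \<in> laurent_span X Y C T"
  using assms by induction (auto intro: laurent_span.intros)

lemma span_diff:
  assumes "u \<in> laurent_span X Y UNIV S" "v \<in> laurent_span X Y UNIV S"
  shows "u - v \<in> laurent_span X Y UNIV S"
  using assms(2)
proof induction
  case zero
  then show ?case using assms(1) by simp
next
  case (add_term v e a)
  have "(u - v) + of_int (- a) * lmon X Y e \<in> laurent_span X Y UNIV S"
    by (intro laurent_span.add_term add_term) auto
  then show ?case by (simp add: algebra_simps)
qed

lemma span_mult:
  assumes "X \<noteq> 0" "Y \<noteq> 0"
    and u: "u \<in> laurent_span X Y C S" and v: "v \<in> laurent_span X Y C T"
    and C: "\<And>a a'. a \<in> C \<Longrightarrow> a' \<in> C \<Longrightarrow> a * a' \<in> C"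
    and R: "\<And>i j i' j'. (i, j) \<in> S \<Longrightarrow> (i', j') \<in> T \<Longrightarrow> (i + i', j + j') \<in> R"
  shows "u * v \<in> laurent_span X Y C R"
  using v
proof induction
  case zero
  then show ?case by (simp add: laurent_span.zero)
next
  case (add_term v f a')
  have "u * (of_int a' * lmon X Y f) \<in> laurent_span X Y C R"
    using u
  proof induction
    case zero
    then show ?case by (simp add: laurent_span.zero)
  next
    case (add_term u e a)
    have "of_int a * lmon X Y e * (of_int a' * lmon X Y f)
        = of_int (a * a') * lmon X Y (fst e + fst f, snd e + snd f)"
      using lmon_mult[OF assms(1,2), of "fst e" "snd e" "fst f" "snd f"] by (simp add: mult_ac)
    also have "\<dots> \<in> laurent_span X Y C R"
      using add_term \<open>f \<in> T\<close> \<open>a' \<in> C\<close> by (intro span_term R C) auto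
    finally show ?case
      using add_term by (simp only: distrib_right span_add)
  qed
  then show ?case using add_term by (simp add: distrib_left span_add)
qed

lemma span_swap:
  assumes "u \<in> laurent_span X Y C UNIV"
  shows "u \<in> laurent_span Y X C UNIV"
  using assms
proof induction
  case (add_term u e a)
  have "lmon X Y e = lmon Y X (prod.swap e)" by (simp add: lmon_def mult.commute)
  then show ?case using add_term by (auto intro: laurent_span.intros)
qed (rule laurent_span.zero)

lemma span_imp_lsum:
  assumes "u \<in> laurent_span X Y C S" "0 \<in> C" "\<And>a a'. a \<in> C \<Longrightarrow> a' \<in> C \<Longrightarrow> a + a' \<in> C"
  obtains k where "finite {e. k e \<noteq> 0}" "{e. k e \<noteq> 0} \<subseteq> S" "\<And>e. k e \<in> C" "u = lsum X Y k"
proof -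
  from assms(1) have "\<exists>k. finite {e. k e \<noteq> 0} \<and> {e. k e \<noteq> 0} \<subseteq> S \<and> (\<forall>e. k e \<in> C) \<and> u = lsum X Y k"
  proof induction
    case zero
    show ?case by (rule exI[of _ "\<lambda>_. 0"]) (simp add: lsum_def assms(2))
  next
    case (add_term u e a)
    then obtain k where k: "finite {e. k e \<noteq> 0}" "{e. k e \<noteq> 0} \<subseteq> S" "\<forall>e. k e \<in> C" "u = lsum X Y k"
      by blast
    let ?l = "\<lambda>f. if f = e then a else 0"
    have l: "finite {f. ?l f \<noteq> 0}"
      by (rule finite_subset[of _ "{e}"]) auto
    have "lsum X Y ?l = of_int a * lmon X Y e"
      by (subst lsum_superset[of "{e}"]) auto
    then have "u + of_int a * lmon X Y e = lsum X Y (\<lambda>f. k f + ?l f)"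
      using lsum_add[OF k(1) l, of X Y] k(4) by simp
    moreover have "{f. k f + ?l f \<noteq> 0} \<subseteq> S" using k(2) add_term by auto
    moreover have "k f + ?l f \<in> C" for f
      using assms(3)[OF k(3)[rule_format, of f], of "?l f"] \<open>a \<in> C\<close> assms(2) by simp
    ultimately show ?case
      using finite_support_add[OF k(1) l] by (intro exI[of _ "\<lambda>f. k f + ?l f"]) auto
  qed
  then show ?thesis using that by blast
qed

section \<open>Edges of Newton polygons\<close>

abbreviation eval_int :: "int poly \<Rightarrow> 'a :: field \<Rightarrow> 'a" where
  "eval_int p Y \<equiv> poly (map_poly of_int p) Y"

lemma eval_int_mult: "eval_int (p * q) Y = eval_int p Y * eval_int q Y"
  by (simp add: map_poly_of_int_mult)

lemma eval_int_diff: "eval_int (p - q) Y = eval_int p Y - eval_int q Y"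
  by (simp add: map_poly_of_int_diff)

lemma eval_int_power: "eval_int (p ^ n) Y = eval_int p Y ^ n"
  by (induction n) (simp_all add: eval_int_mult)

lemma eval_int_sum:
  assumes "\<And>t. t > D \<Longrightarrow> coeff p t = 0"
  shows "eval_int p Y = (\<Sum>t\<le>D. of_int (coeff p t) * Y ^ t)"
proof -
  have "degree (map_poly of_int p :: 'a poly) \<le> D"
    using assms by (intro degree_le) (auto simp: coeff_map_poly)
  then have "eval_int p Y = (\<Sum>t\<le>D. coeff (map_poly of_int p) t * Y ^ t)"
    unfolding poly_altdef by (intro sum.mono_neutral_left) (auto simp: coeff_eq_0)
  then show ?thesis by (simp add: coeff_map_poly)
qed

lemma finite_support_box:
  fixes k :: "int \<times> int \<Rightarrow> int"
  assumes "finite {e. k e \<noteq> 0}"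
  obtains N :: nat where "{e. k e \<noteq> 0} \<subseteq> {- int N..int N} \<times> {- int N..int N}"
proof -
  have fin: "finite ((\<lambda>e. nat (\<bar>fst e\<bar> + \<bar>snd e\<bar>)) ` {e. k e \<noteq> 0})" using assms by simp
  obtain N where "\<forall>n\<in>(\<lambda>e. nat (\<bar>fst e\<bar> + \<bar>snd e\<bar>)) ` {e. k e \<noteq> 0}. n \<le> N"
    using finite_nat_set_iff_bounded_le[THEN iffD1, OF fin] ..
  then have N: "nat (\<bar>fst e\<bar> + \<bar>snd e\<bar>) \<le> N" if "k e \<noteq> 0" for e
    using that by blast
  have "{e. k e \<noteq> 0} \<subseteq> {- int N..int N} \<times> {- int N..int N}"
    using N by fastforce
  then show ?thesis by (rule that)
qed

text \<open>
  The coefficient of \<open>X powi i\<close> in a Laurent sum, shifted to a genuine polynomial in \<open>Y\<close>.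
\<close>
definition column :: "nat \<Rightarrow> (int \<times> int \<Rightarrow> int) \<Rightarrow> int \<Rightarrow> int poly" where
  "column N k i = (\<Sum>t\<le>2 * N. monom (k (i, int t - int N)) t)"

lemma coeff_column:
  assumes "{e. k e \<noteq> 0} \<subseteq> {- int N..int N} \<times> {- int N..int N}"
  shows "coeff (column N k i) t = k (i, int t - int N)"
proof -
  have "coeff (column N k i) t = (if t \<le> 2 * N then k (i, int t - int N) else 0)"
    by (simp add: column_def coeff_sum)
  moreover have "k (i, int t - int N) = 0" if "\<not> t \<le> 2 * N"
    using assms that by force
  ultimately show ?thesis by simp
qed

lemma lsum_columns:
  assumes box: "{e. k e \<noteq> 0} \<subseteq> {- int N..int N} \<times> {- int N..int N}" and "Y \<noteq> 0"
  shows "lsum X Y k * Y ^ N = (\<Sum>i\<in>{- int N..int N}. X powi i * eval_int (column N k i) Y)"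
proof -
  have "lsum X Y k * Y ^ N = (\<Sum>i\<in>{- int N..int N}. \<Sum>j\<in>{- int N..int N}.
      of_int (k (i, j)) * lmon X Y (i, j) * Y ^ N)"
    by (subst lsum_superset[OF _ box])
       (simp_all add: sum.cartesian_product sum_distrib_right case_prod_unfold)
  also have "\<dots> = (\<Sum>i\<in>{- int N..int N}. X powi i * eval_int (column N k i) Y)"
  proof (rule sum.cong[OF refl])
    fix i
    have "eval_int (column N k i) Y = (\<Sum>t\<le>2 * N. of_int (k (i, int t - int N)) * Y ^ t)"
      using box by (subst eval_int_sum[of "2 * N"]) (auto simp: coeff_column)
    also have "\<dots> = (\<Sum>j\<in>{- int N..int N}. of_int (k (i, j)) * Y ^ nat (j + int N))"
      by (rule sum.reindex_bij_witness[of _ "\<lambda>j. nat (j + int N)" "\<lambda>t. int t - int N"]) auto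
    finally have "X powi i * eval_int (column N k i) Y
        = (\<Sum>j\<in>{- int N..int N}. X powi i * (of_int (k (i, j)) * Y ^ nat (j + int N)))"
      by (simp add: sum_distrib_left)
    also have "\<dots> = (\<Sum>j\<in>{- int N..int N}. of_int (k (i, j)) * lmon X Y (i, j) * Y ^ N)"
    proof (rule sum.cong[OF refl])
      fix j assume "j \<in> {- int N..int N}"
      then have "Y ^ nat (j + int N) = Y powi j * Y ^ N"
        using \<open>Y \<noteq> 0\<close> power_int_add[of Y j "int N"] by (simp add: power_int_nonneg_exp)
      then show "X powi i * (of_int (k (i, j)) * Y ^ nat (j + int N))
          = of_int (k (i, j)) * lmon X Y (i, j) * Y ^ N"
        by (simp add: lmon_def mult_ac)
    qed
    finally show "(\<Sum>j\<in>{- int N..int N}. of_int (k (i, j)) * lmon X Y (i, j) * Y ^ N)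
        = X powi i * eval_int (column N k i) Y" ..
  qed
  finally show ?thesis .
qed

lemma laurent_independent_columns:
  assumes indep: "laurent_independent X Y" and "finite F"
    and sum0: "(\<Sum>i\<in>F. X powi i * eval_int (q i) Y) = 0" and "i \<in> F"
  shows "q i = 0"
proof -
  obtain D where D: "\<And>i. i \<in> F \<Longrightarrow> degree (q i) \<le> D"
    using finite_nat_set_iff_bounded_le[THEN iffD1, of "(\<lambda>i. degree (q i)) ` F"] \<open>finite F\<close> by auto
  define k where "k = (\<lambda>(i, j). if i \<in> F \<and> 0 \<le> j then coeff (q i) (nat j) else 0)"
  have supp: "{e. k e \<noteq> 0} \<subseteq> F \<times> {0..int D}"
  proof
    fix e assume "e \<in> {e. k e \<noteq> 0}"
    then have e: "fst e \<in> F" "0 \<le> snd e" "coeff (q (fst e)) (nat (snd e)) \<noteq> 0"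
      by (cases e; simp add: k_def split: if_splits)+
    then have "nat (snd e) \<le> D" using D le_degree le_trans by blast
    with e show "e \<in> F \<times> {0..int D}"
      unfolding mem_Times_iff by simp
  qed
  then have fin: "finite {e. k e \<noteq> 0}"
    using finite_subset \<open>finite F\<close> by blast
  have "lsum X Y k = (\<Sum>i\<in>F. \<Sum>j\<in>{0..int D}. of_int (k (i, j)) * lmon X Y (i, j))"
    using \<open>finite F\<close>
    by (subst lsum_superset[OF _ supp]) (simp_all add: sum.cartesian_product case_prod_unfold)
  also have "\<dots> = (\<Sum>i\<in>F. X powi i * eval_int (q i) Y)"
  proof (rule sum.cong[OF refl])
    fix i assume i: "i \<in> F"
    have "eval_int (q i) Y = (\<Sum>t\<le>D. of_int (coeff (q i) t) * Y ^ t)"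
      using D[OF i] by (intro eval_int_sum) (simp add: coeff_eq_0)
    also have "\<dots> = (\<Sum>j\<in>{0..int D}. of_int (k (i, j)) * Y powi j)"
      using i by (intro sum.reindex_bij_witness[of _ nat int]) (auto simp: k_def)
    finally show "(\<Sum>j\<in>{0..int D}. of_int (k (i, j)) * lmon X Y (i, j)) = X powi i * eval_int (q i) Y"
      by (simp add: lmon_def sum_distrib_left mult_ac)
  qed
  finally have "\<forall>e. k e = 0"
    using indep fin sum0 unfolding laurent_independent_def by metis
  then have "k (i, int t) = 0" for t by blast
  then show ?thesis
    using \<open>i \<in> F\<close> by (intro poly_eqI) (simp add: k_def)
qed

text \<open>
  The lowest and the highest terms of a product are the products of the lowest and of the highest
  terms, so multiplication by \<open>(1 + y\<^sup>c)\<^sup>p\<close> widens the support by exactly \<open>c * p\<close>.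
\<close>
lemma mult_binomial_power_support:
  fixes q r :: "int poly"
  assumes "q = r * (1 + monom 1 c) ^ p"
    and supp: "\<And>t. coeff q t \<noteq> 0 \<Longrightarrow> lo \<le> int t \<and> int t < lo + int (c * p)"
  shows "q = 0"
proof (rule ccontr)
  assume "q \<noteq> 0"
  with assms(1) have "r \<noteq> 0" by auto
  from \<open>q \<noteq> 0\<close> supp have "c > 0" "p > 0"
    by (metis add.right_neutral bot_nat_0.not_eq_extremum leading_coeff_0_iff less_le_not_le
        mult_is_0 of_nat_0)+
  let ?E = "(1 + monom 1 c) ^ p :: int poly"
  have "coeff (1 + monom 1 c :: int poly) c = 1" using \<open>c > 0\<close> by (simp add: coeff_1)
  moreover have "degree (1 + monom 1 c :: int poly) \<le> c"
    by (rule order.trans[OF degree_add_le_max]) (auto simp: degree_monom_eq)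
  ultimately have "degree (1 + monom 1 c :: int poly) = c"
    by (metis le_antisym le_degree zero_neq_one)
  moreover have E: "?E \<noteq> 0" using \<open>q \<noteq> 0\<close> assms(1) by force
  ultimately have deg: "degree ?E = c * p"
    using \<open>p > 0\<close> by (simp add: degree_power_eq mult.commute)
  have E0: "coeff ?E 0 = 1"
    using \<open>c > 0\<close> by (simp add: poly_0_coeff_0[symmetric] poly_monom zero_power)
  define s where "s = (LEAST s. coeff r s \<noteq> 0)"
  have "coeff r (degree r) \<noteq> 0" using \<open>r \<noteq> 0\<close> by simp
  then have s: "coeff r s \<noteq> 0" and below: "\<And>i. i < s \<Longrightarrow> coeff r i = 0"
    unfolding s_def by (rule LeastI, auto dest: not_less_Least)
  have "coeff q s = (\<Sum>i\<le>s. coeff r i * coeff ?E (s - i))"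
    by (simp add: assms(1) coeff_mult)
  also have "\<dots> = (\<Sum>i\<in>{s}. coeff r i * coeff ?E (s - i))"
    by (rule sum.mono_neutral_right) (auto simp: below)
  finally have "coeff q s \<noteq> 0" using s E0 by simp
  then have low: "lo \<le> int s" using supp by blast
  have "degree q = degree r + c * p"
    using \<open>r \<noteq> 0\<close> E deg by (simp add: assms(1) degree_mult_eq)
  then have "int (degree r) < lo"
    using supp[of "degree q"] leading_coeff_neq_0[OF \<open>q \<noteq> 0\<close>] by simp
  moreover have "s \<le> degree r" using s by (rule le_degree)
  ultimately show False using low by simp
qed

text \<open>
  If \<open>X * W = Y\<^sup>c + 1\<close> and an element is a Laurent sum both in \<open>X, Y\<close> and in \<open>Y, W\<close>, then
  substituting \<open>W = (Y\<^sup>c + 1) / X\<close> shows that the coefficient of \<open>X powi (- p)\<close> is divisible by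
  \<open>(Y\<^sup>c + 1)\<^sup>p\<close>. Such a coefficient cannot be supported on fewer than \<open>c * p + 1\<close>
  consecutive exponents unless it is zero.
\<close>
lemma short_edge_vanishes:
  fixes X Y W :: "'a :: field"
  assumes indep: "laurent_independent X Y" and nz: "X \<noteq> 0" "Y \<noteq> 0" "W \<noteq> 0"
    and exch: "X * W = Y ^ c + 1"
    and fin: "finite {e. k e \<noteq> 0}" "finite {e. l e \<noteq> 0}"
    and eq: "lsum X Y k = lsum Y W l"
    and short: "\<And>j. k (- int p, j) \<noteq> 0 \<Longrightarrow> lo \<le> j \<and> j < lo + int (c * p)"
  shows "k (- int p, j) = 0"
proof -
  let ?l = "l \<circ> prod.swap"
  have fin_l: "finite {e. ?l e \<noteq> 0}" by (rule finite_support_swap[OF fin(2)])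
  obtain N1 where N1: "{e. k e \<noteq> 0} \<subseteq> {- int N1..int N1} \<times> {- int N1..int N1}"
    by (rule finite_support_box[OF fin(1)])
  obtain N2 where N2: "{e. ?l e \<noteq> 0} \<subseteq> {- int N2..int N2} \<times> {- int N2..int N2}"
    by (rule finite_support_box[OF fin_l])
  define N where "N = max p (max N1 N2)"
  have boxk: "{e. k e \<noteq> 0} \<subseteq> {- int N..int N} \<times> {- int N..int N}"
    by (rule order.trans[OF N1]) (auto simp: N_def)
  have boxl: "{e. ?l e \<noteq> 0} \<subseteq> {- int N..int N} \<times> {- int N..int N}"
    by (rule order.trans[OF N2]) (auto simp: N_def)
  define E :: "int poly" where "E = 1 + monom 1 c"
  define q where "q = column N k"
  define r where "r = column N ?l"
  have E: "eval_int E Y = X * W"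
  proof -
    have "map_poly of_int E = (1 + monom 1 c :: 'a poly)"
      by (intro poly_eqI) (simp add: E_def coeff_map_poly coeff_1)
    then show ?thesis by (simp add: poly_monom exch)
  qed
  have "(\<Sum>i\<in>{- int N..int N}. X powi i * eval_int (q i) Y)
      = (\<Sum>d\<in>{- int N..int N}. W powi d * eval_int (r d) Y)"
    using lsum_columns[OF boxk nz(2), of X] lsum_columns[OF boxl nz(2), of W] eq
    by (simp add: q_def r_def lsum_swap del: o_apply)
  also have "\<dots> = (\<Sum>i\<in>{- int N..int N}. W powi (- i) * eval_int (r (- i)) Y)"
    by (rule sum.reindex_bij_witness[of _ uminus uminus]) auto
  finally have main: "(\<Sum>i\<in>{- int N..int N}. X powi i * eval_int (q i) Y)
      = (\<Sum>i\<in>{- int N..int N}. W powi (- i) * eval_int (r (- i)) Y)" .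
  \<comment> \<open>Multiplication by \<open>(X * W) ^ N\<close> makes every exponent of \<open>Y\<^sup>c + 1\<close> nonnegative.\<close>
  have step: "(X * W) ^ N * W powi (- i) = X powi i * eval_int (E ^ nat (int N - i)) Y"
    if "i \<in> {- int N..int N}" for i
  proof -
    have "(X * W) ^ nat (int N - i) = (X * W) powi (int N + - i)"
      using that by (simp add: power_int_nonneg_exp)
    also have "\<dots> = (X * W) ^ N * (X powi (- i) * W powi (- i))"
      using nz by (subst power_int_add) (auto simp: power_int_mult_distrib)
    finally show ?thesis
      using nz by (simp add: eval_int_power E power_int_minus field_simps)
  qed
  have "(\<Sum>i\<in>{- int N..int N}. X powi i * eval_int (q i * E ^ N) Y)
      = (X * W) ^ N * (\<Sum>i\<in>{- int N..int N}. X powi i * eval_int (q i) Y)"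
    by (simp add: eval_int_mult eval_int_power E sum_distrib_left mult_ac)
  also have "\<dots> = (\<Sum>i\<in>{- int N..int N}. ((X * W) ^ N * W powi (- i)) * eval_int (r (- i)) Y)"
    unfolding main by (simp add: sum_distrib_left mult_ac)
  also have "\<dots> = (\<Sum>i\<in>{- int N..int N}. X powi i * eval_int (r (- i) * E ^ nat (int N - i)) Y)"
    by (rule sum.cong[OF refl], subst step) (simp_all add: eval_int_mult mult_ac)
  finally have "(\<Sum>i\<in>{- int N..int N}.
      X powi i * eval_int (q i * E ^ N - r (- i) * E ^ nat (int N - i)) Y) = 0"
    by (simp add: eval_int_diff right_diff_distrib sum_subtractf)
  then have "q (- int p) * E ^ N - r p * E ^ nat (int N + int p) = 0"
    using laurent_independent_columns[OF indep _ , of "{- int N..int N}"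
        "\<lambda>i. q i * E ^ N - r (- i) * E ^ nat (int N - i)" "- int p"]
    by (auto simp: N_def)
  then have "q (- int p) * E ^ N = r p * E ^ p * E ^ N"
    by (simp add: nat_add_distrib power_add mult_ac)
  moreover have "E \<noteq> 0" using E nz by auto
  ultimately have qr: "q (- int p) = r p * E ^ p" by simp
  have "q (- int p) = 0"
    by (rule mult_binomial_power_support[OF qr[unfolded E_def], of "lo + int N"])
       (use short in \<open>fastforce simp: q_def coeff_column[OF boxk]\<close>)
  then have "k (- int p, int t - int N) = 0" for t
    using coeff_column[OF boxk, of "- int p" t] by (simp add: q_def)
  from this[of "nat (j + int N)"] show ?thesis
  proof (cases "j + int N \<ge> 0")
    case False
    then show ?thesis using boxk by force
  qed simp
qed

text \<open>
  Two exchange relations \<open>X * W' = Y\<^sup>2\<^sup>h + 1\<close> and \<open>Y * W = X\<^sup>b + 1\<close> with \<open>b * h = 2\<close>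
  leave no room for a Laurent sum whose Newton polygon lies in an open-sided triangle
  \<open>i \<ge> - p\<close>, \<open>j \<ge> - q\<close>, \<open>h * i + j < 0\<close>: the left leg is shorter than \<open>q + h * p\<close> and
  divisibility asks for \<open>2 * h * p\<close>; the bottom leg is shorter than \<open>p + q / h\<close> and divisibility
  asks for \<open>b * q = 2 * q / h\<close>. So one leg is too short according to whether \<open>q \<le> h * p\<close> or
  not, and stripping it off makes the triangle smaller.
\<close>
lemma triangle_vanishes:
  fixes X Y W W' :: "'a :: field"
  assumes indep: "laurent_independent X Y"
    and nz: "X \<noteq> 0" "Y \<noteq> 0" "W \<noteq> 0" "W' \<noteq> 0"
    and exch: "X * W' = Y ^ (2 * h) + 1" "Y * W = X ^ b + 1" and bh: "b * h = 2"
    and fin: "finite {e. k e \<noteq> 0}" "finite {e. l e \<noteq> 0}" "finite {e. l' e \<noteq> 0}"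
    and eq: "lsum X Y k = lsum W X l" "lsum X Y k = lsum Y W' l'"
    and supp: "\<And>i j. k (i, j) \<noteq> 0 \<Longrightarrow> - p \<le> i \<and> - q \<le> j \<and> int h * i + j < 0"
  shows "k e = 0"
  using supp
proof (induction "nat p + nat q" arbitrary: p q e rule: less_induct)
  case less
  note supp = less.prems
  have h: "int h > 0" using bh by (cases h) auto
  consider (empty) "p \<le> 0" "q \<le> 0" | (left) "q \<le> int h * p" "p > 0" | (bottom) "int h * p < q" "q > 0"
    using h by (smt (verit) mult_nonneg_nonneg zero_less_mult_iff mult_nonneg_nonpos)
  then show ?case
  proof cases
    case empty
    obtain i j where e: "e = (i, j)" by (cases e)
    show ?thesis
    proof (rule ccontr)
      assume "k e \<noteq> 0"
      from supp[OF this[unfolded e]] empty have "0 \<le> i" "0 \<le> j" "int h * i + j < 0" by auto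
      then show False using h by (smt (verit) mult_nonneg_nonneg)
    qed
  next
    case left
    have "k (- int (nat p), j) = 0" for j
    proof (rule short_edge_vanishes[OF indep nz(1,2,4) exch(1) fin(1,3) eq(2), of "nat p" "- q"])
      fix j assume "k (- int (nat p), j) \<noteq> 0"
      then have "- q \<le> j" "j < int h * p" using supp left by fastforce+
      then show "- q \<le> j \<and> j < - q + int (2 * h * nat p)" using left by simp
    qed
    then have edge: "k (- p, j) = 0" for j using left by simp
    show ?thesis
    proof (rule less.hyps[of "p - 1" q])
      fix i j assume ij: "k (i, j) \<noteq> 0"
      then have "i \<noteq> - p" using edge by auto
      then show "- (p - 1) \<le> i \<and> - q \<le> j \<and> int h * i + j < 0" using supp[OF ij] by auto
    qed (use left in auto)
  next
    case bottom
    have fin': "finite {e. (k \<circ> prod.swap) e \<noteq> 0}" "finite {e. (l \<circ> prod.swap) e \<noteq> 0}"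
      by (rule finite_support_swap[OF fin(1)], rule finite_support_swap[OF fin(2)])
    have eq': "lsum Y X (k \<circ> prod.swap) = lsum X W (l \<circ> prod.swap)"
      unfolding lsum_swap by (rule eq(1))
    have "(k \<circ> prod.swap) (- int (nat q), i) = 0" for i
    proof (rule short_edge_vanishes[OF laurent_independent_swap[OF indep] nz(2,1,3) exch(2) fin' eq',
          of "nat q" "- p"])
      fix i assume "(k \<circ> prod.swap) (- int (nat q), i) \<noteq> 0"
      then have i: "- p \<le> i" "int h * i < q" using supp[of i "- q"] bottom by auto
      have "int h * (- p + int b * q) = 2 * q - int h * p"
        using bh by (simp add: algebra_simps flip: of_nat_mult)
      with i bottom have "int h * i < int h * (- p + int b * q)" by linarith
      then have "i < - p + int b * q" using h by simp
      then show "- p \<le> i \<and> i < - p + int (b * nat q)" using i bottom by simp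
    qed
    then have edge: "k (i, - q) = 0" for i using bottom by simp
    show ?thesis
    proof (rule less.hyps[of p "q - 1"])
      fix i j assume ij: "k (i, j) \<noteq> 0"
      then have "j \<noteq> - q" using edge by auto
      then show "- p \<le> i \<and> - (q - 1) \<le> j \<and> int h * i + j < 0" using supp[OF ij] by auto
    qed (use bottom in auto)
  qed
qed

section \<open>Algebraic independence of the initial cluster\<close>

lemma of_int_fract: "of_int a = (Fract (of_int a) 1 :: 'a :: idom fract)"
  by (cases a) (simp_all add: of_nat_fract One_fract_def)

lemma Fract_sum: "(\<Sum>e\<in>F. Fract (f e) 1) = (Fract (sum f F) 1 :: 'a :: idom fract)"
  by (induction F rule: infinite_finite_induct) (simp_all add: Zero_fract_def)

lemma Fract_power: "Fract f 1 ^ n = (Fract (f ^ n) 1 :: 'a :: idom fract)"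
  by (induction n) (simp_all add: One_fract_def)

lemma monom_monom_eq:
  "monom (monom (of_int a) i) j = (of_int a * [:[:0, 1:]:] ^ i * [:0, 1:] ^ j :: rat poly poly)"
proof -
  have "[:[:0, 1:]:] ^ i = ([:[:0, 1:] ^ i:] :: rat poly poly)"
    by (induction i) (simp_all add: mult.commute)
  moreover have "of_int a * [:[:0, 1:] ^ i:] = ([:of_int a * [:0, 1:] ^ i:] :: rat poly poly)"
    by (simp add: of_int_poly)
  moreover have "of_int a * [:0, 1:] ^ i = (monom (of_int a) i :: rat poly)"
    by (simp add: of_int_poly monom_altdef)
  ultimately show ?thesis
    by (simp add: monom_altdef)
qed

definition cleared_numerator ::
    "int \<Rightarrow> int \<Rightarrow> (int \<times> int) set \<Rightarrow> (int \<times> int \<Rightarrow> int) \<Rightarrow> rat poly poly" where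
  "cleared_numerator p q F k =
     (\<Sum>e\<in>F. monom (monom (of_int (k e)) (nat (fst e + p))) (nat (snd e + q)))"

lemma clear_denominators:
  assumes "\<And>e. e \<in> F \<Longrightarrow> - p \<le> fst e \<and> - q \<le> snd e"
  shows "(\<Sum>e\<in>F. of_int (k e) * lmon (cluster_var b c 1) (cluster_var b c 2) e) *
      (cluster_var b c 1 powi p * cluster_var b c 2 powi q) = Fract (cleared_numerator p q F k) 1"
proof -
  let ?X = "cluster_var b c 1" and ?Y = "cluster_var b c 2"
  have XY: "?X = Fract [:[:0, 1:]:] 1" "?Y = Fract [:0, 1:] 1"
    by (simp_all add: cluster_var.simps)
  have nz: "?X \<noteq> 0" "?Y \<noteq> 0" by (simp_all add: cluster_var_nonzero)
  have "of_int (k e) * lmon ?X ?Y e * (?X powi p * ?Y powi q) =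
      Fract (monom (monom (of_int (k e)) (nat (fst e + p))) (nat (snd e + q))) 1" if "e \<in> F" for e
  proof -
    have "lmon ?X ?Y e * (?X powi p * ?Y powi q) = ?X powi (fst e + p) * ?Y powi (snd e + q)"
      using nz by (simp add: lmon_def power_int_add)
    also have "\<dots> = ?X ^ nat (fst e + p) * ?Y ^ nat (snd e + q)"
      using assms[OF that] by (simp add: power_int_nonneg_exp)
    finally show ?thesis
      by (simp add: mult.assoc of_int_fract XY Fract_power monom_monom_eq)
  qed
  then show ?thesis
    by (simp add: sum_distrib_right cleared_numerator_def Fract_sum)
qed

lemma coeff_cleared_numerator:
  assumes "finite F" "\<And>e. e \<in> F \<Longrightarrow> - p \<le> fst e \<and> - q \<le> snd e" "(i, j) \<in> F"
  shows "coeff (coeff (cleared_numerator p q F k) (nat (j + q))) (nat (i + p)) = of_int (k (i, j))"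
proof -
  have "coeff (coeff (monom (monom (of_int (k e)) (nat (fst e + p))) (nat (snd e + q)))
      (nat (j + q))) (nat (i + p)) = (if e = (i, j) then of_int (k (i, j)) else (0 :: rat))"
    if "e \<in> F" for e
    using assms(2)[OF that] assms(2)[OF assms(3)] by (cases e) auto
  then have "coeff (coeff (cleared_numerator p q F k) (nat (j + q))) (nat (i + p))
      = (\<Sum>e\<in>F. if e = (i, j) then of_int (k (i, j)) else (0 :: rat))"
    by (simp add: cleared_numerator_def coeff_sum)
  then show ?thesis using assms(1,3) by simp
qed

lemma laurent_independent_initial_cluster:
  "laurent_independent (cluster_var b c 1) (cluster_var b c 2)"
  unfolding laurent_independent_def
proof (intro allI impI, rule ccontr)
  fix k :: "int \<times> int \<Rightarrow> int" and e
  assume fin: "finite {e. k e \<noteq> 0}" and sum0: "lsum (cluster_var b c 1) (cluster_var b c 2) k = 0"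
    and e: "k e \<noteq> 0"
  obtain N :: nat where N: "{e. k e \<noteq> 0} \<subseteq> {- int N..int N} \<times> {- int N..int N}"
    by (rule finite_support_box[OF fin])
  have box: "- int N \<le> fst e \<and> - int N \<le> snd e" if "e \<in> {e. k e \<noteq> 0}" for e
    using that N by force
  have "Fract (cleared_numerator N N {e. k e \<noteq> 0} k) 1 = 0"
    using clear_denominators[of "{e. k e \<noteq> 0}" "int N" "int N" k b c, OF box] sum0
    by (simp add: lsum_def)
  then have "cleared_numerator N N {e. k e \<noteq> 0} k = 0"
    by (simp add: Zero_fract_def eq_fract)
  then show False
    using coeff_cleared_numerator[OF fin box, of "fst e" "snd e" k] e by simp
qed

section \<open>The normalised Chebyshev polynomials\<close>

text \<open>
  At \<open>n = 0\<close> this sequence takes the value 2, for which the recursion is valid from the start.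
\<close>
fun lucas :: "'a :: comm_ring_1 \<Rightarrow> nat \<Rightarrow> 'a" where
  "lucas x 0 = 2"
| "lucas x (Suc 0) = x"
| "lucas x (Suc (Suc n)) = x * lucas x (Suc n) - lucas x n"

lemma eval_int_lucas: "eval_int (lucas [:0, 1:] n) x = lucas x n"
proof (induction x n rule: lucas.induct)
  case (1 x)
  show ?case by (simp add: numeral_poly map_poly_pCons)
qed (simp_all add: map_poly_pCons eval_int_diff eval_int_mult)

lemma lucas_add_inverse:
  fixes t :: "'a :: field"
  assumes "t \<noteq> 0"
  shows "lucas (t + inverse t) n = t ^ n + inverse t ^ n"
  using assms by (induction "t + inverse t" n rule: lucas.induct) (simp_all add: field_simps)

lemma cheb_T_eq_lucas:
  assumes "n > 0"
  shows "cheb_T n = lucas [:0, 1:] n"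
  using assms unfolding cheb_T_def
  by (simp add: the1_equality[OF cheb_T_ex1] eval_int_lucas lucas_add_inverse)

text \<open>
  \<open>lucas (a + d) n\<close> is the trace of the \<open>n\<close>-th power of the matrix with rows
  \<open>(a, a * d - 1)\<close> and \<open>(1, d)\<close>, whose determinant is 1. The numbers \<open>A, B\<close> and \<open>C, D\<close> below
  are the rows of that power, so nothing is ever subtracted.
\<close>
lemma lucas_in_semiring:
  assumes P: "0 \<in> P" "1 \<in> P" "\<And>u v. u \<in> P \<Longrightarrow> v \<in> P \<Longrightarrow> u + v \<in> P"
      "\<And>u v. u \<in> P \<Longrightarrow> v \<in> P \<Longrightarrow> u * v \<in> P"
    and ad: "a \<in> P" "d \<in> P" "a * d - 1 \<in> P"
  shows "lucas (a + d) n \<in> P"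
proof -
  have "\<exists>A\<in>P. \<exists>B\<in>P. \<exists>C\<in>P. \<exists>D\<in>P. lucas (a + d) n = A + D \<and>
      lucas (a + d) (Suc n) = a * A + B + (a * d - 1) * C + d * D"
  proof (induction n)
    case 0
    show ?case by (rule bexI[of _ 1], rule bexI[of _ 0], rule bexI[of _ 0], rule bexI[of _ 1])
        (use P in auto)
  next
    case (Suc n)
    then obtain A B C D where ABCD: "A \<in> P" "B \<in> P" "C \<in> P" "D \<in> P"
      and tr: "lucas (a + d) n = A + D"
        "lucas (a + d) (Suc n) = a * A + B + (a * d - 1) * C + d * D" by blast
    show ?case
    proof (intro bexI conjI)
      show "lucas (a + d) (Suc n) = (a * A + B) + ((a * d - 1) * C + d * D)"
        by (simp add: tr add.assoc)
      show "lucas (a + d) (Suc (Suc n)) = a * (a * A + B) + ((a * d - 1) * A + d * B)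
          + (a * d - 1) * (a * C + D) + d * ((a * d - 1) * C + d * D)"
        by (simp add: tr algebra_simps)
    qed (intro P(3,4) ABCD ad)+
  qed
  then obtain A D where "A \<in> P" "D \<in> P" "lucas (a + d) n = A + D" by blast
  then show ?thesis using P(3) by simp
qed

section \<open>The element z in every cluster\<close>

text \<open>
  Both affine types satisfy \<open>c = 2 * h\<close>, \<open>b * h = 2\<close> and \<open>(X\<^sup>b + 1)\<^sup>h = X\<^sup>2 + (2 * h - 2) * X + 1\<close>.
  Apart from the definition of \<open>z\<close>, only these identities enter, so the two cases can be
  treated together.
\<close>
locale affine_rank_two =
  fixes b c h :: nat
  assumes types: "b = 2 \<and> c = 2 \<and> h = 1 \<or> b = 1 \<and> c = 4 \<and> h = 2"
begin

abbreviation y :: "int \<Rightarrow> ratfun" where "y \<equiv> cluster_var b c"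
abbreviation z :: ratfun where "z \<equiv> z_elem b c"

lemma h_pos: "h > 0" and bh: "b * h = 2" and c_eq: "c = 2 * h"
  using types by auto

lemma binomial: "((X :: ratfun) ^ b + 1) ^ h = X ^ 2 + of_nat (2 * h - 2) * X + 1"
  using types by (auto simp: power2_eq_square algebra_simps)

lemma exchange_even: "even m \<Longrightarrow> y (m - 1) * y (m + 1) = y m ^ (2 * h) + 1"
  using cluster_var_exchange[of b c m] by (simp add: c_eq)

lemma exchange_odd: "odd m \<Longrightarrow> y (m - 1) * y (m + 1) = y m ^ b + 1"
  using cluster_var_exchange[of b c m] by simp

text \<open>
  For four consecutive cluster variables \<open>W, Y, X, V\<close>, the right-hand side is symmetric under
  \<open>Y \<leftrightarrow> V\<close>; this makes the left-hand side independent of the position.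
\<close>
lemma symmetric_form:
  fixes X Y V W :: ratfun
  assumes nz: "X \<noteq> 0" "Y \<noteq> 0" and exch: "Y * V = X ^ b + 1" "X * W = Y ^ (2 * h) + 1"
  shows "(X + W + of_nat (2 * h - 2)) / Y ^ h = (Y ^ h + V ^ h) / X"
proof -
  have "(X + W + of_nat (2 * h - 2)) * X = (X ^ 2 + of_nat (2 * h - 2) * X + 1) + Y ^ (2 * h)"
    using exch(2) by (simp add: power2_eq_square algebra_simps)
  also have "\<dots> = (Y * V) ^ h + Y ^ (2 * h)"
    by (simp only: exch(1) binomial)
  also have "\<dots> = Y ^ h * V ^ h + Y ^ h * Y ^ h"
    by (simp add: power_mult_distrib mult_2 power_add)
  finally show ?thesis using nz by (simp add: frac_eq_eq algebra_simps)
qed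

lemma z_even:
  assumes "even m"
  shows "z = (y (m - 1) + y (m + 1) + of_nat (2 * h - 2)) / y m ^ h"
proof -
  define f where "f k = (y (2 * k - 1) + y (2 * k + 1) + of_nat (2 * h - 2)) / y (2 * k) ^ h" for k
  have nz: "y i \<noteq> 0" for i by (rule cluster_var_nonzero)
  have step: "f (k + 1) = f k" for k
  proof -
    have exch: "y (2 * k) * y (2 * k + 2) = y (2 * k + 1) ^ b + 1"
      "y (2 * k + 2) * y (2 * k) = y (2 * k + 1) ^ b + 1"
      "y (2 * k + 1) * y (2 * k - 1) = y (2 * k) ^ (2 * h) + 1"
      "y (2 * k + 1) * y (2 * k + 3) = y (2 * k + 2) ^ (2 * h) + 1"
      using exchange_odd[of "2 * k + 1"] exchange_even[of "2 * k"] exchange_even[of "2 * k + 2"]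
      by (simp_all add: add.commute mult.commute[of "y _" "y _"])
    have "f k = (y (2 * k + 1) + y (2 * k - 1) + of_nat (2 * h - 2)) / y (2 * k) ^ h"
      by (simp add: f_def add.commute)
    also have "\<dots> = (y (2 * k) ^ h + y (2 * k + 2) ^ h) / y (2 * k + 1)"
      by (intro symmetric_form nz exch)
    also have "\<dots> = (y (2 * k + 2) ^ h + y (2 * k) ^ h) / y (2 * k + 1)"
      by (simp add: add.commute)
    also have "\<dots> = (y (2 * k + 1) + y (2 * k + 3) + of_nat (2 * h - 2)) / y (2 * k + 2) ^ h"
      by (intro symmetric_form[symmetric] nz exch)
    finally show ?thesis by (simp add: f_def algebra_simps)
  qed
  have "f k = f 1" for k
  proof (induction k rule: int_induct[where k = 1])
    case (step1 i) then show ?case using step[of i] by simp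
  next
    case (step2 i) then show ?case using step[of "i - 1"] by simp
  qed simp
  moreover have "z = f 1"
  proof -
    have exch: "y 0 * y 2 = y 1 ^ b + 1" "y 1 * y 3 = y 2 ^ c + 1"
      using exchange_odd[of 1] exchange_even[of 2] by (simp_all add: c_eq)
    from types show ?thesis
    proof
      assume t: "b = 2 \<and> c = 2 \<and> h = 1"
      have "z = y 0 * y 3 - y 1 * y 2" using t by (simp add: z_elem_def Let_def)
      moreover have "(y 0 * y 3 - y 1 * y 2) * y 2 = y 1 + y 3"
      proof -
        have "y 0 * y 2 = y 1 ^ 2 + 1" "y 1 * y 3 = y 2 ^ 2 + 1" using exch t by simp_all
        then show ?thesis by algebra
      qed
      ultimately show ?thesis
        using t nz[of 2] by (simp add: f_def nonzero_eq_divide_eq)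
    next
      assume t: "b = 1 \<and> c = 4 \<and> h = 2"
      have "z = y 0 ^ 2 * y 3 - (y 1 + 2) * y 2 ^ 2" using t by (simp add: z_elem_def Let_def)
      moreover have "(y 0 ^ 2 * y 3 - (y 1 + 2) * y 2 ^ 2) * y 2 ^ 2 = y 1 + y 3 + 2"
      proof -
        have "y 0 * y 2 = y 1 + 1" "y 1 * y 3 = y 2 ^ 4 + 1" using exch t by simp_all
        then show ?thesis by algebra
      qed
      ultimately show ?thesis
        using t nz[of 2] by (simp add: f_def nonzero_eq_divide_eq)
    qed
  qed
  moreover obtain k where "m = 2 * k" using assms by blast
  ultimately show ?thesis by (simp add: f_def)
qed

lemma z_laurent:
  assumes "even m" "m' = m + 1 \<or> m' = m - 1"
  defines "L \<equiv> lmon (y m') (y m)"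
  shows "z = L (1, - int h) + (L (- 1, int h) + L (- 1, - int h) + of_int (2 * int h - 2) * L (0, - int h))"
proof -
  define X Y W where "X = y m'" and "Y = y m" and "W = y (2 * m - m')"
  have nz: "X \<noteq> 0" "Y \<noteq> 0" by (simp_all add: X_def Y_def cluster_var_nonzero)
  have "z = (X + W + of_nat (2 * h - 2)) / Y ^ h"
    using z_even[OF assms(1)] assms(2) by (auto simp: X_def Y_def W_def add_ac)
  moreover have "X * W = Y ^ (2 * h) + 1"
    using exchange_even[OF assms(1)] assms(2)
    by (auto simp: X_def Y_def W_def mult.commute[of "y _" "y _"])
  then have "W = (Y ^ (2 * h) + 1) / X"
    using nz by (simp add: nonzero_eq_divide_eq mult.commute)
  moreover have "(of_nat (2 * h - 2) :: ratfun) = of_int (2 * int h - 2)"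
    using h_pos by (simp add: of_nat_diff)
  ultimately have "z = (X + (Y ^ (2 * h) + 1) / X + of_int (2 * int h - 2)) / Y ^ h"
    by simp
  also have "\<dots> = X / Y ^ h + (Y ^ h / X + 1 / (X * Y ^ h) + of_int (2 * int h - 2) / Y ^ h)"
  proof -
    have "(X + (A * A + 1) / X + e) / A = X / A + (A / X + 1 / (X * A) + e / A)"
      if "A \<noteq> 0" for A e :: ratfun
      using that nz by (simp add: add_divide_distrib)
    moreover have "Y ^ (2 * h) = Y ^ h * Y ^ h" by (simp add: mult_2 power_add)
    moreover have "Y ^ h \<noteq> 0" using nz by simp
    ultimately show ?thesis by (simp only: not_False_eq_True)
  qed
  finally show ?thesis
    by (simp add: L_def lmon_def X_def[symmetric] Y_def[symmetric] power_int_minus divide_inverse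
        mult_ac)
qed

text \<open>
  The term \<open>a\<close> is a monomial whose inverse is one of the terms of \<open>d\<close>. This is why
  subtracting 1 from \<open>a * d\<close> leaves nonnegative coefficients.
\<close>
lemma lucas_z_subtraction_free:
  "lucas z n \<in> laurent_span (y m) (y (m + 1)) {0..} UNIV"
proof -
  have *: "lucas z n \<in> laurent_span (y m') (y m) {0..} UNIV"
    if m: "even m" "m' = m + 1 \<or> m' = m - 1" for m m'
  proof -
    let ?L = "lmon (y m') (y m)"
    let ?P = "laurent_span (y m') (y m) {0..} UNIV"
    let ?a = "?L (1, - int h)"
    let ?d = "?L (- 1, int h) + ?L (- 1, - int h) + of_int (2 * int h - 2) * ?L (0, - int h)"
    have nz: "y m' \<noteq> 0" "y m \<noteq> 0" by (rule cluster_var_nonzero)+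
    have "1 = ?L (0, 0)" by (simp add: lmon_def)
    then have one: "1 \<in> ?P" using span_lmon[of "(0, 0)" UNIV "{0..}" "y m'" "y m"] by simp
    have "?a * ?L (- 1, int h) = 1" by (simp add: lmon_mult[OF nz]) (simp add: lmon_def)
    then have det: "?a * ?d - 1 = ?L (0, - int h - int h)
        + of_int (2 * int h - 2) * ?L (1, - int h - int h)"
      by (simp add: distrib_left lmon_mult[OF nz] mult.left_commute)
    have "lucas (?a + ?d) n \<in> ?P"
    proof (rule lucas_in_semiring[OF laurent_span.zero one span_add])
      show "u * v \<in> ?P" if "u \<in> ?P" "v \<in> ?P" for u v
        using that by (rule span_mult[OF nz]) auto
      show "?a \<in> ?P" by (rule span_lmon) auto
      show "?d \<in> ?P" using h_pos by (intro span_add span_lmon span_term) auto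
      show "?a * ?d - 1 \<in> ?P"
        unfolding det using h_pos by (intro span_add span_lmon span_term) auto
    qed
    then show ?thesis by (simp only: z_laurent[OF m])
  qed
  show ?thesis
  proof (cases "even m")
    case True
    then show ?thesis using *[of m "m + 1"] span_swap by simp
  next
    case False
    then show ?thesis using *[of "m + 1" m] by simp
  qed
qed

section \<open>The Newton polygon of the Chebyshev elements\<close>

abbreviation M :: "int \<Rightarrow> int \<Rightarrow> ratfun" where "M i j \<equiv> lmon (y 1) (y 2) (i, j)"

definition triangle :: "int \<Rightarrow> (int \<times> int) set" where
  "triangle n = {(i, j). - n \<le> i \<and> - (n * int h) \<le> j \<and> int h * i + j < 0}"

lemma y_nz: "y 1 \<noteq> 0" "y 2 \<noteq> 0"
  by (rule cluster_var_nonzero)+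

lemma M_mult: "M i j * M i' j' = M (i + i') (j + j')"
  by (rule lmon_mult[OF y_nz])

lemma z_initial: "z = M 1 (- int h) + (M (- 1) (int h) + M (- 1) (- int h)
    + of_int (2 * int h - 2) * M 0 (- int h))"
  using z_laurent[of 2 1] by simp

text \<open>
  With \<open>t = y\<^sub>1 / y\<^sub>2\<^sup>h\<close>, the element \<open>z\<close> is \<open>t + t\<^sup>-\<^sup>1\<close> plus terms strictly below the line
  \<open>h * i + j = 0\<close>, and the recursion for \<open>T\<^sub>n\<close> reproduces \<open>t\<^sup>n + t\<^sup>-\<^sup>n\<close> on that line: the
  third edge of the Newton triangle carries its two end points only.
  The corner term of \<open>z\<^sub>n\<close>, for \<open>n > 0\<close>, is the \<open>n\<close>-th power of the corner term of \<open>z\<close>.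
  Separating it from the other terms fails at \<open>n = 0\<close>, where the value is 2; hence the two
  claims are staggered by one step.
\<close>
lemma lucas_z_terms:
  "lucas z n - M n (- (n * h)) - M (- n) (n * h) \<in> laurent_span (y 1) (y 2) UNIV (triangle n) \<and>
   lucas z (Suc n) - M (Suc n) (- (Suc n * h)) - M (- Suc n) (Suc n * h) - M (- Suc n) (- (Suc n * h))
     \<in> laurent_span (y 1) (y 2) UNIV (triangle (Suc n) - {(- Suc n, - (Suc n * h))})"
proof (induction n)
  case 0
  have "M 0 0 = 1" by (simp add: lmon_def)
  moreover have "z - M 1 (- int h) - M (- 1) (int h) - M (- 1) (- int h) = of_int (2 * int h - 2) * M 0 (- int h)"
    by (simp add: z_initial)
  moreover have "\<dots> \<in> laurent_span (y 1) (y 2) UNIV (triangle 1 - {(- 1, - int h)})"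
    using h_pos by (intro span_term) (auto simp: triangle_def)
  ultimately show ?case by (simp add: laurent_span.zero)
next
  case (Suc n)
  let ?S = "\<lambda>S. laurent_span (y 1) (y 2) UNIV S"
  define N where "N = int n + 1"
  define H where "H = int h"
  have N: "N \<ge> 1" "int (Suc n) = N" "int n = N - 1" "int (Suc (Suc n)) = N + 1" by (auto simp: N_def)
  have H: "H \<ge> 1" using h_pos by (simp add: H_def)
  \<comment> \<open>\<open>T k = t\<^sup>k + t\<^sup>-\<^sup>k\<close> is the part on the line, \<open>K k\<close> the corner term.\<close>
  define T where "T k = M k (- (k * H)) + M (- k) (k * H)" for k
  define K where "K k = M (- k) (- (k * H))" for k
  define D where "D = lucas z (Suc n) - T N"
  define D0 where "D0 = lucas z n - T (N - 1)"
  define D' where "D' = lucas z (Suc n) - T N - K N"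
  define w where "w = of_int (2 * H - 2) * M 0 (- H)"
  define R where "R = triangle (N + 1) - {(- (N + 1), - ((N + 1) * H))}"
  have D0: "D0 \<in> ?S (triangle (N - 1))"
    using Suc by (simp add: D0_def T_def N H_def diff_diff_eq)
  have D': "D' \<in> ?S (triangle N - {(- N, - (N * H))})"
    using Suc by (simp add: D'_def T_def K_def H_def N(2) diff_diff_eq add.assoc del: of_nat_Suc mult_Suc)
  have NH: "N * H \<ge> 1" using N H by (smt (verit) mult_less_cancel_left2)
  have KN: "K N \<in> ?S (triangle N)"
    unfolding K_def using N H NH
    by (intro span_lmon) (auto simp: triangle_def H_def[symmetric] mult.commute)
  have "D = D' + K N" by (simp add: D_def D'_def)
  then have D: "D \<in> ?S (triangle N)"
    using span_add[OF span_mono[OF D'] KN] by auto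
  have zw: "z = T 1 + K 1 + w"
    by (simp add: z_initial T_def K_def w_def H_def)
  have TT: "T 1 * T N = T (N + 1) + T (N - 1)"
    by (simp add: T_def distrib_left distrib_right M_mult)
       (simp add: algebra_simps minus_diff_commute)
  have KK: "K 1 * K N = K (N + 1)"
    by (simp add: K_def M_mult) (simp add: algebra_simps minus_diff_commute)
  have rec: "lucas z (Suc (Suc n)) - T (N + 1) - K (N + 1)
      = (T 1 + w) * K N + z * D' + (K 1 + w) * T N - D0"
  proof -
    have "lucas z (Suc (Suc n)) = z * (T N + K N) + z * D' - (T (N - 1) + D0)"
      by (simp add: D'_def D0_def distrib_left[symmetric])
    also have "z * (T N + K N) = T 1 * T N + K 1 * K N + (T 1 + w) * K N + (K 1 + w) * T N"
      by (subst zw) (simp add: algebra_simps)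
    finally show ?thesis by (simp add: TT KK)
  qed
  have mult: "u * v \<in> ?S R" if "u \<in> ?S U" "v \<in> ?S V"
    "\<And>i j i' j'. (i, j) \<in> U \<Longrightarrow> (i', j') \<in> V \<Longrightarrow> (i + i', j + j') \<in> R" for u v U V
    using that by (intro span_mult[OF y_nz that(1,2)]) auto
  let ?Z = "{(1, - H), (- 1, H), (- 1, - H), (0, - H)}"
  have w: "w \<in> ?S {(0, - H)}" unfolding w_def by (rule span_term) auto
  have T: "T k \<in> ?S {(k, - (k * H)), (- k, k * H)}" for k
    unfolding T_def by (intro span_add span_lmon) auto
  have K: "K k \<in> ?S {(- k, - (k * H))}" for k
    unfolding K_def by (intro span_lmon) auto
  have T1w: "T 1 + w \<in> ?S {(1, - H), (- 1, H), (0, - H)}"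
    using T[of 1] by (intro span_add; intro span_mono[OF w] span_mono[OF T[of 1]]) auto
  have K1w: "K 1 + w \<in> ?S {(- 1, - H), (0, - H)}"
    by (intro span_add; intro span_mono[OF w] span_mono[OF K[of 1]]) auto
  have Z: "z \<in> ?S ?Z"
    unfolding zw by (intro span_add; intro span_mono[OF w] span_mono[OF K[of 1]] span_mono[OF T[of 1]]) auto
  define P where "P = N * H"
  have P: "P \<ge> 1" "H * N = P" "N * H = P" using NH by (simp_all add: P_def mult.commute)
  have succ: "(N + 1) * H = P + H" and pred: "(N - 1) * H = P - H"
    by (simp_all add: P_def algebra_simps)
  have R: "(i, j) \<in> R"
    if "- N - 1 \<le> i" "- P - H \<le> j" "H * i + j < 0" "i \<noteq> - N - 1 \<or> j \<noteq> - P - H" for i j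
    using that by (simp add: R_def triangle_def H_def[symmetric] succ)
  have "lucas z (Suc (Suc n)) - T (N + 1) - K (N + 1) \<in> ?S R"
    unfolding rec
  proof (intro span_add span_diff)
    show "(T 1 + w) * K N \<in> ?S R"
      by (rule mult[OF T1w K], rule R) (use N(1) H P in \<open>auto simp: right_diff_distrib distrib_left\<close>)
    show "z * D' \<in> ?S R"
    proof (rule mult[OF Z D'])
      fix i j i' j' :: int
      assume ij: "(i, j) \<in> ?Z" and ij': "(i', j') \<in> triangle N - {(- N, - (N * H))}"
      from ij' have "- N \<le> i'" "- P \<le> j'" "H * i' + j' < 0" "i' \<noteq> - N \<or> j' \<noteq> - P"
        by (auto simp: triangle_def H_def[symmetric] P)
      with ij H show "(i + i', j + j') \<in> R"
        by (intro R) (auto simp: distrib_left)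
    qed
    show "(K 1 + w) * T N \<in> ?S R"
      by (rule mult[OF K1w T], rule R) (use N(1) H P in \<open>auto simp: right_diff_distrib distrib_left\<close>)
    have "(i, j) \<in> R" if "(i, j) \<in> triangle (N - 1)" for i j
      using that H by (intro R) (auto simp: triangle_def H_def[symmetric] pred)
    then show "D0 \<in> ?S R"
      by (intro span_mono[OF D0]) auto
  qed
  then show ?case
    using D by (simp add: D_def T_def K_def R_def N(2,4) H_def[symmetric] diff_diff_eq add.assoc
        del: of_nat_Suc mult_Suc lucas.simps)
qed

lemma lucas_z_expansion:
  assumes "n > 0"
  obtains k where "finite {e. k e \<noteq> 0}" "lucas z n = lsum (y 1) (y 2) k"
    "\<And>i j. k (i, j) \<noteq> 0 \<Longrightarrow> (i, j) \<in> triangle n \<or>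
        (i, j) = (int n, - (int n * int h)) \<or> (i, j) = (- int n, int n * int h)"
    "k (- int n, - (int n * int h)) = 1"
proof -
  obtain n' where n: "n = Suc n'" using assms by (cases n) auto
  define A where "A = {(int n, - (int n * int h)), (- int n, int n * int h), (- int n, - (int n * int h))}"
  have nh: "int n * int h > 0" using assms h_pos by simp
  have "lucas z n - M n (- (n * h)) - M (- n) (n * h) - M (- n) (- (n * h))
      \<in> laurent_span (y 1) (y 2) UNIV (triangle n - {(- int n, - (int n * int h))})"
    using lucas_z_terms[of n'] by (simp add: n del: of_nat_Suc mult_Suc)
  then obtain k where k: "finite {e. k e \<noteq> 0}"
    "{e. k e \<noteq> 0} \<subseteq> triangle n - {(- int n, - (int n * int h))}"
    "lucas z n - M n (- (n * h)) - M (- n) (n * h) - M (- n) (- (n * h)) = lsum (y 1) (y 2) k"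
    by (rule span_imp_lsum) auto
  let ?l = "\<lambda>e. if e \<in> A then 1 else 0 :: int"
  have l: "finite {e. ?l e \<noteq> 0}" by (rule finite_subset[of _ A]) (auto simp: A_def)
  have "lsum (y 1) (y 2) ?l = (\<Sum>e\<in>A. of_int (?l e) * lmon (y 1) (y 2) e)"
    by (rule lsum_superset) (auto simp: A_def)
  also have "\<dots> = M n (- (n * h)) + (M (- n) (n * h) + M (- n) (- (n * h)))"
    using h_pos assms by (simp add: A_def)
  finally have "lucas z n = lsum (y 1) (y 2) (\<lambda>e. k e + ?l e)"
    unfolding lsum_add[OF k(1) l] k(3)[symmetric] by simp
  moreover have "(i, j) \<in> triangle n \<or> (i, j) = (int n, - (int n * int h)) \<or> (i, j) = (- int n, int n * int h)"
    if "k (i, j) + ?l (i, j) \<noteq> 0" for i j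
  proof -
    have "(- int n, - (int n * int h)) \<in> triangle n"
      using nh by (simp add: triangle_def mult.commute)
    moreover from that have "(i, j) \<in> {e. k e \<noteq> 0} \<or> (i, j) \<in> A" by (auto split: if_splits)
    ultimately show ?thesis using k(2) by (auto simp: A_def)
  qed
  moreover have "k (- int n, - (int n * int h)) + ?l (- int n, - (int n * int h)) = 1"
    using k(2) by (auto simp: A_def)
  ultimately show ?thesis
    using that[of "\<lambda>e. k e + ?l e"] finite_support_add[OF k(1) l] by blast
qed

text \<open>
  Clearing denominators moves the corner of the Newton triangle to the origin, so the corner
  coefficient becomes the constant term of the numerator.
\<close>
lemma has_denominator_lucas_z:
  assumes "n > 0"
  shows "has_denominator b c (int n, int n * int h) (lucas z n)"
proof -
  obtain k where k: "finite {e. k e \<noteq> 0}" "lucas z n = lsum (y 1) (y 2) k"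
    "\<And>i j. k (i, j) \<noteq> 0 \<Longrightarrow> (i, j) \<in> triangle n \<or>
        (i, j) = (int n, - (int n * int h)) \<or> (i, j) = (- int n, int n * int h)"
    "k (- int n, - (int n * int h)) = 1"
    by (rule lucas_z_expansion[OF assms]) blast
  let ?F = "{e. k e \<noteq> 0}"
  let ?N = "cleared_numerator (int n) (int n * int h) ?F k"
  have F: "- int n \<le> fst e \<and> - (int n * int h) \<le> snd e" if "e \<in> ?F" for e
    using k(3)[of "fst e" "snd e"] that by (auto simp: triangle_def)
  have "coeff (coeff ?N 0) 0 = 1"
    using coeff_cleared_numerator[OF k(1) F, of "- int n" "- (int n * int h)" k] k(4) by simp
  moreover have "lucas z n = Fract ?N 1 / (y 1 powi int n * y 2 powi (int n * int h))"
    using clear_denominators[of ?F "int n" "int n * int h" k b c, OF F] y_nz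
    by (simp add: k(2) lsum_def nonzero_eq_divide_eq)
  ultimately show ?thesis
    unfolding has_denominator_def by (intro exI[of _ ?N]) simp
qed

lemma laurent_expansion_iff:
  "laurent_expansion b c m u k \<longleftrightarrow> finite {e. k e \<noteq> 0} \<and> u = lsum (y m) (y (m + 1)) k"
  by (simp add: laurent_expansion_def lsum_def lmon_def)

section \<open>Positivity and indecomposability\<close>

lemma cluster_algebra_add:
  assumes "u \<in> cluster_algebra b c" "v \<in> cluster_algebra b c"
  shows "u + v \<in> cluster_algebra b c"
proof -
  have "u - ((1 - 1) - v) \<in> cluster_algebra b c"
    by (intro cluster_algebra.diff cluster_algebra.one assms)
  then show ?thesis by simp
qed

lemma z_in_cluster_algebra: "z \<in> cluster_algebra b c"
proof -
  have "y 1 + 2 \<in> cluster_algebra b c"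
    using cluster_algebra_add[OF cluster_algebra_add[OF cluster_algebra.var cluster_algebra.one]
        cluster_algebra.one, of 1] by (simp add: add.commute)
  then show ?thesis
    using types by (auto simp: z_elem_def Let_def power2_eq_square
        intro!: cluster_algebra.diff cluster_algebra.mult cluster_algebra.var)
qed

lemma lucas_z_in_cluster_algebra: "lucas z n \<in> cluster_algebra b c"
proof (induction z n rule: lucas.induct)
  case 1
  show ?case using cluster_algebra_add[OF cluster_algebra.one cluster_algebra.one] by simp
qed (auto intro: z_in_cluster_algebra cluster_algebra.diff cluster_algebra.mult)

lemma lucas_z_positive:
  assumes "n > 0"
  shows "lucas z n \<in> positive_elements b c"
proof -
  obtain N where "coeff (coeff N 0) 0 = 1"
    "lucas z n = Fract N 1 / (y 1 powi int n * y 2 powi (int n * int h))"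
    using has_denominator_lucas_z[OF assms] by (auto simp: has_denominator_def)
  moreover from this(1) have "Fract N 1 \<noteq> 0" by (auto simp: Zero_fract_def eq_fract)
  ultimately have "lucas z n \<noteq> 0" using y_nz by simp
  moreover have "\<exists>k. laurent_expansion b c m (lucas z n) k \<and> (\<forall>e. k e \<noteq> 0 \<longrightarrow> k e > 0)" for m
  proof -
    obtain k where "finite {e. k e \<noteq> 0}" "\<And>e. k e \<in> {0..}" "lucas z n = lsum (y m) (y (m + 1)) k"
      by (rule span_imp_lsum[OF lucas_z_subtraction_free[of n m]]) auto
    then show ?thesis
      by (intro exI[of _ k]) (auto simp: laurent_expansion_iff order.strict_iff_order)
  qed
  ultimately show ?thesis
    using lucas_z_in_cluster_algebra by (simp add: positive_elements_def)
qed

text \<open>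
  If the corner were missing, the left leg of the Newton triangle would have length
  \<open>2 * h * n - 1\<close> and the bottom leg length \<open>2 * n - 1\<close>, each one unit too short for the
  divisibility that the neighbouring cluster imposes. Both legs would vanish, and with them the
  two remaining vertices on the line \<open>h * i + j = 0\<close>; nothing fits into the open triangle
  that is left.
\<close>
lemma positive_in_triangle_has_corner:
  assumes "v \<in> positive_elements b c" "finite {e. k e \<noteq> 0}" "v = lsum (y 1) (y 2) k"
    and supp: "\<And>i j. k (i, j) \<noteq> 0 \<Longrightarrow> (i, j) \<in> triangle n \<or>
        (i, j) = (int n, - (int n * int h)) \<or> (i, j) = (- int n, int n * int h)"
    and "n > 0"
  shows "k (- int n, - (int n * int h)) \<noteq> 0"
proof
  assume corner: "k (- int n, - (int n * int h)) = 0"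
  have nh: "int n * int h > 0" using \<open>n > 0\<close> h_pos by simp
  obtain l where l: "finite {e. l e \<noteq> 0}" "lsum (y 1) (y 2) k = lsum (y 0) (y 1) l"
    using assms(1,3) by (force simp: positive_elements_def laurent_expansion_iff dest: spec[of _ 0])
  obtain l' where l': "finite {e. l' e \<noteq> 0}" "lsum (y 1) (y 2) k = lsum (y 2) (y 3) l'"
    using assms(1,3) by (force simp: positive_elements_def laurent_expansion_iff dest: spec[of _ 2])
  have exch: "y 1 * y 3 = y 2 ^ (2 * h) + 1" "y 2 * y 0 = y 1 ^ b + 1"
    using exchange_even[of 2] exchange_odd[of 1] by (simp_all add: mult.commute)
  have nz: "y 1 \<noteq> 0" "y 2 \<noteq> 0" "y 0 \<noteq> 0" "y 3 \<noteq> 0" by (rule cluster_var_nonzero)+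
  have indep: "laurent_independent (y 1) (y 2)" by (rule laurent_independent_initial_cluster)
  have left: "k (- int n, j) = 0" for j
  proof (rule short_edge_vanishes[OF indep nz(1,2,4) exch(1) assms(2) l'(1,2), of n "1 - int n * int h"])
    fix j assume j: "k (- int n, j) \<noteq> 0"
    then have "- (int n * int h) \<le> j" "j \<le> int n * int h"
      using supp[OF j] nh \<open>n > 0\<close> by (auto simp: triangle_def mult.commute)
    moreover have "j \<noteq> - (int n * int h)" using j corner by auto
    ultimately show "1 - int n * int h \<le> j \<and> j < 1 - int n * int h + int (2 * h * n)"
      by (auto simp: mult.commute)
  qed
  have swapped: "finite {e. (k \<circ> prod.swap) e \<noteq> 0}" "finite {e. (l \<circ> prod.swap) e \<noteq> 0}"
    "lsum (y 2) (y 1) (k \<circ> prod.swap) = lsum (y 1) (y 0) (l \<circ> prod.swap)"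
    using finite_support_swap[OF assms(2)] finite_support_swap[OF l(1)] l(2)
    by (simp_all only: lsum_swap)
  have "(k \<circ> prod.swap) (- int (n * h), i) = 0" for i
  proof (rule short_edge_vanishes[OF laurent_independent_swap[OF indep] nz(2,1,3) exch(2) swapped,
        of "n * h" "1 - int n"])
    fix i assume "(k \<circ> prod.swap) (- int (n * h), i) \<noteq> 0"
    then have i: "k (i, - (int n * int h)) \<noteq> 0" by simp
    have "int h * i \<le> int h * int n" if "int h * i + - (int n * int h) < 0"
      using that by (simp add: mult.commute)
    then have "i \<le> int n" if "int h * i + - (int n * int h) < 0"
      using that h_pos mult_le_cancel_left_pos[of "int h" i "int n"] by simp
    with supp[OF i] nh have "- int n \<le> i" "i \<le> int n"
      by (auto simp: triangle_def)
    moreover have "i \<noteq> - int n" using i corner by auto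
    moreover have "b * (n * h) = n * 2"
      by (simp only: bh[symmetric] mult_ac)
    ultimately show "1 - int n \<le> i \<and> i < 1 - int n + int (b * (n * h))"
      by (simp only: of_nat_mult of_nat_numeral) linarith
  qed
  then have bottom: "k (i, - (int n * int h)) = 0" for i by simp
  have "k e = 0" for e
  proof (rule triangle_vanishes[OF indep nz exch bh assms(2) l(1) l'(1) l(2) l'(2)])
    fix i j assume "k (i, j) \<noteq> 0"
    then show "- int n \<le> i \<and> - (int n * int h) \<le> j \<and> int h * i + j < 0"
      using supp[of i j] left[of j] bottom[of i] by (auto simp: triangle_def)
  qed
  then have "v = 0" by (simp add: assms(3) lsum_def)
  then show False using assms(1) by (simp add: positive_elements_def)
qed

text \<open>
  Subtraction-free expansions cannot cancel, so both summands stay inside the Newton polygon of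
  the sum; its corner coefficient is 1, so one of the summands misses the corner.
\<close>
lemma lucas_z_indecomposable:
  assumes "n > 0" "u \<in> positive_elements b c" "v \<in> positive_elements b c"
  shows "lucas z n \<noteq> u + v"
proof
  assume uv: "lucas z n = u + v"
  obtain k where k: "finite {e. k e \<noteq> 0}" "lucas z n = lsum (y 1) (y 2) k"
    "\<And>i j. k (i, j) \<noteq> 0 \<Longrightarrow> (i, j) \<in> triangle n \<or>
        (i, j) = (int n, - (int n * int h)) \<or> (i, j) = (- int n, int n * int h)"
    "k (- int n, - (int n * int h)) = 1"
    by (rule lucas_z_expansion[OF assms(1)]) blast
  have pos: "\<exists>k. finite {e. k e \<noteq> 0} \<and> w = lsum (y 1) (y 2) k \<and> (\<forall>e. k e \<ge> 0)"
    if "w \<in> positive_elements b c" for w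
  proof -
    obtain k where "laurent_expansion b c 1 w k" "\<forall>e. k e \<noteq> 0 \<longrightarrow> k e > 0"
      using \<open>w \<in> positive_elements b c\<close> unfolding positive_elements_def by blast
    moreover from this(2) have "\<forall>e. k e \<ge> 0" by (metis less_imp_le order_refl)
    ultimately show ?thesis by (auto simp: laurent_expansion_iff)
  qed
  obtain ku where ku: "finite {e. ku e \<noteq> 0}" "u = lsum (y 1) (y 2) ku" "\<forall>e. ku e \<ge> 0"
    using pos[OF assms(2)] by blast
  obtain kv where kv: "finite {e. kv e \<noteq> 0}" "v = lsum (y 1) (y 2) kv" "\<forall>e. kv e \<ge> 0"
    using pos[OF assms(3)] by blast
  have "k = (\<lambda>e. ku e + kv e)"
    using laurent_independent_unique[OF laurent_independent_initial_cluster k(1)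
        finite_support_add[OF ku(1) kv(1)], of b c] lsum_add[OF ku(1) kv(1), of "y 1" "y 2"] uv k(2) ku(2) kv(2)
    by simp
  then have sum: "k e = ku e + kv e" for e by simp
  have nn: "ku e \<ge> 0" "kv e \<ge> 0" for e using ku(3) kv(3) by blast+
  have below: "ku e \<noteq> 0 \<or> kv e \<noteq> 0 \<Longrightarrow> k e \<noteq> 0" for e
    using sum[of e] nn[of e] by linarith
  have "ku (- int n, - (int n * int h)) = 0 \<or> kv (- int n, - (int n * int h)) = 0"
    using k(4) sum[of "(- int n, - (int n * int h))"] nn[of "(- int n, - (int n * int h))"] by linarith
  moreover have "ku (- int n, - (int n * int h)) \<noteq> 0"
    by (rule positive_in_triangle_has_corner[OF assms(2) ku(1,2) k(3) assms(1)]) (use below in blast)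
  moreover have "kv (- int n, - (int n * int h)) \<noteq> 0"
    by (rule positive_in_triangle_has_corner[OF assms(3) kv(1,2) k(3) assms(1)]) (use below in blast)
  ultimately show False by blast
qed

end

text \<open>
  A combination with total multiplicity at least 2 splits off one copy of some member of \<open>B\<close>
  and leaves a nonempty combination.
\<close>
lemma indecomposable_in_basis:
  assumes "w \<in> positive_combinations B"
    and indec: "\<And>u v. u \<in> positive_combinations B \<Longrightarrow> v \<in> positive_combinations B \<Longrightarrow> w \<noteq> u + v"
  shows "w \<in> B"
proof -
  obtain S k where S: "finite S" "S \<noteq> {}" "S \<subseteq> B" "\<forall>s\<in>S. k s > (0 :: int)"
    and w: "w = (\<Sum>s\<in>S. of_int (k s) * s)"
    using assms(1) unfolding positive_combinations_def by blast
  obtain s where s: "s \<in> S" using S(2) by blast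
  have "s = (\<Sum>s\<in>{s}. of_int 1 * s)" by simp
  then have s_pos: "s \<in> positive_combinations B"
    unfolding positive_combinations_def
    by (intro CollectI exI[of _ "{s}"] exI[of _ "\<lambda>_. 1"]) (use s S in auto)
  define k' where "k' = k(s := k s - 1)"
  define S' where "S' = {t \<in> S. k' t > 0}"
  have "w = (\<Sum>t\<in>S. (if t = s then s else 0) + of_int (k' t) * t)"
    unfolding w by (rule sum.cong) (auto simp: k'_def algebra_simps)
  also have "\<dots> = s + (\<Sum>t\<in>S. of_int (k' t) * t)"
    using s S(1) by (simp add: sum.distrib)
  also have "(\<Sum>t\<in>S. of_int (k' t) * t) = (\<Sum>t\<in>S'. of_int (k' t) * t)"
    by (rule sum.mono_neutral_right) (use S in \<open>force simp: S'_def k'_def split: if_splits\<close>)+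
  finally have split: "w = s + (\<Sum>t\<in>S'. of_int (k' t) * t)" .
  have "S' = {}"
  proof (rule ccontr)
    assume "S' \<noteq> {}"
    then have "(\<Sum>t\<in>S'. of_int (k' t) * t) \<in> positive_combinations B"
      unfolding positive_combinations_def using S
      by (intro CollectI exI[of _ S'] exI[of _ k']) (auto simp: S'_def)
    then show False using indec[OF s_pos] split by blast
  qed
  then show ?thesis using split s S(3) by auto
qed

theorem proposition2p11:
  fixes b c n :: nat
    and B :: "ratfun set"
    and x :: "int \<times> int \<Rightarrow> ratfun"
  assumes "(b, c) = (2, 2) \<or> (b, c) = (1, 4)"
    and "canonical_basis b c B"
    and "bij_betw x UNIV B"
    and "\<And>\<alpha> w. w = x \<alpha> \<longleftrightarrow> w \<in> B \<and> has_denominator b c \<alpha> w"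
    and "n > 0"
  shows "x (int n * fst (delta b c), int n * snd (delta b c)) = z_seq b c n"
proof -
  define h where "h = c div 2"
  interpret affine_rank_two b c h
    using assms(1) by unfold_locales (auto simp: h_def)
  have basis: "positive_elements b c = positive_combinations B"
    using assms(2) by (simp add: canonical_basis_def)
  have "lucas z n \<in> B"
    using lucas_z_positive[OF assms(5)] lucas_z_indecomposable[OF assms(5)]
    unfolding basis by (rule indecomposable_in_basis)
  moreover have "(int n * fst (delta b c), int n * snd (delta b c)) = (int n, int n * int h)"
    using assms(1) by (auto simp: delta_def h_def)
  ultimately have "lucas z n = x (int n * fst (delta b c), int n * snd (delta b c))"
    using has_denominator_lucas_z[OF assms(5)] assms(4) by metis
  moreover have "z_seq b c n = lucas z n"
    using assms(5) by (simp add: z_seq_def cheb_T_eq_lucas eval_int_lucas)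
  ultimately show ?thesis by simp
qed

end
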